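(* Let $(\theta_n)_{n\ge n_{\mathrm{st}}}$ be a sequence in $\Theta$ and let $(\xi_n)_{n\ge n_{\mathrm{st}}}$ be a sequence of designs generated from it by the Wynn-type algorithm described in the context. If $\lim_{n\to\infty}\theta_n=\overline{\theta}$ for some $\overline{\theta}\in\Theta$, then for every sequence $\theta_n'\in\Theta$, $n\ge n_{\mathrm{st}}$, such that $\lim_{n\to\infty}\theta_n'=\overline{\theta}$ one has $$\lim_{n\to\infty}M(\xi_n,\theta_n')\,=\,M(\xi^*_{\overline{\theta}},\overline{\theta}),$$ where $\xi^*_{\overline{\theta}}$ denotes a locally D-optimal design at $\overline{\theta}$, i.e., $\xi^*_{\overline{\theta}}$ maximizes $\det\bigl(M(\xi,\overline{\theta})\bigr)$ over the set of all designs $\xi$.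
   Context: Let $p\in\mathbb{N}$ and let $\mathcal{X}$ (experimental region) and $\Theta$ (parameter space) be nonempty compact metric spaces. For each $\theta\in\Theta$ a function $f_\theta:\mathcal{X}\to\mathbb{R}^p$ is given such that $\mathrm{span}\{f_\theta(x):x\in\mathcal{X}\}=\mathbb{R}^p$ for every $\theta\in\Theta$, and the map $(x,\theta)\mapsto f_\theta(x)$ is continuous on $\mathcal{X}\times\Theta$. No further structure of $f_\theta$ is assumed. A design $\xi$ is a probability measure on $\mathcal{X}$ with finite support; $\xi(x)$ denotes the weight of the point $x$. Its information matrix at $\theta$ is the $p\times p$ matrix $M(\xi,\theta)=\sum_{x\in\mathrm{supp}(\xi)}\xi(x)\,f_\theta(x)f_\theta(x)^{T}$. $\delta_x$ is the point mass at $x$. Algorithm: Fix $n_{\mathrm{st}}\in\mathbb{N}$ and points $x_1,\dots,x_{n_{\mathrm{st}}}\in\mathcal{X}$ such that $\xi_{n_{\mathrm{st}}}=\frac{1}{n_{\mathrm{st}}}\sum_{i=1}^{n_{\mathrm{st}}}\delta_{x_i}$ has $M(\xi_{n_{\mathrm{st}}},\theta)$ positive definite for all $\theta\in\Theta$. Given a sequence $\theta_n\in\Theta$, $n\ge n_{\mathrm{st}}$, for every $n\ge n_{\mathrm{st}}$ put $\xi_n=\frac1n\sum_{i=1}^n\delta_{x_i}$ and let $x_{n+1}$ be a maximizer of $x\mapsto f_{\theta_n}(x)^{T}M^{-1}(\xi_n,\theta_n)f_{\theta_n}(x)$ over $x\in\mathcal{X}$. (All $M(\xi_n,\theta)$,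 $n\ge n_{\mathrm{st}}$, $\theta\in\Theta$, are then positive definite.) *)

theory Defs
  imports "HOL-Probability.Probability"
begin

definition pos_def_matrix :: "real^'n^'n \<Rightarrow> bool" where
  "pos_def_matrix A \<longleftrightarrow> transpose A = A \<and> (\<forall>v. v \<noteq> 0 \<longrightarrow> v \<bullet> (A *v v) > 0)"

text \<open>The product \<open>v w\<^sup>T\<close> of a column vector and a row vector.\<close>

definition outer_product :: "real^'n \<Rightarrow> real^'n \<Rightarrow> real^'n^'n" where
  "outer_product v w = (\<chi> i j. v $ i * w $ j)"

text \<open>A finitely supported probability measure on \<open>X\<close> is represented by a probability mass
  function; \<open>pmf \<xi> x\<close> is the weight of \<open>x\<close> and \<open>set_pmf \<xi>\<close> is the support.\<close>

definition is_design :: "'a set \<Rightarrow> 'a pmf \<Rightarrow> bool" where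
  "is_design X \<xi> \<longleftrightarrow> finite (set_pmf \<xi>) \<and> set_pmf \<xi> \<subseteq> X"

text \<open>The family of regression functions takes the parameter first: \<open>f \<theta> x\<close>.\<close>

definition info_matrix ::
  "('b \<Rightarrow> 'a \<Rightarrow> real^'p) \<Rightarrow> 'a pmf \<Rightarrow> 'b \<Rightarrow> real^'p^'p" where
  "info_matrix f \<xi> \<theta> = (\<Sum>x\<in>set_pmf \<xi>. pmf \<xi> x *\<^sub>R outer_product (f \<theta> x) (f \<theta> x))"

definition locally_D_optimal ::
  "('b \<Rightarrow> 'a \<Rightarrow> real^'p) \<Rightarrow> 'a set \<Rightarrow> 'b \<Rightarrow> 'a pmf \<Rightarrow> bool" where
  "locally_D_optimal f X \<theta> \<xi> \<longleftrightarrow> is_design X \<xi> \<and>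
     (\<forall>\<eta>. is_design X \<eta> \<longrightarrow> det (info_matrix f \<eta> \<theta>) \<le> det (info_matrix f \<xi> \<theta>))"

text \<open>The design \<open>(\<delta>\<^bsub>x 1\<^esub> + \<dots> + \<delta>\<^bsub>x n\<^esub>) / n\<close>, as the distribution of \<open>x i\<close> for \<open>i\<close> uniform on
  \<open>{1..n}\<close>, so that repeated points accumulate weight. Meaningful only for \<open>n \<ge> 1\<close>.\<close>

definition empirical_design :: "(nat \<Rightarrow> 'a) \<Rightarrow> nat \<Rightarrow> 'a pmf" where
  "empirical_design x n = map_pmf x (pmf_of_set {1..n})"

definition sensitivity ::
  "('b \<Rightarrow> 'a \<Rightarrow> real^'p) \<Rightarrow> 'a pmf \<Rightarrow> 'b \<Rightarrow> 'a \<Rightarrow> real" where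
  "sensitivity f \<xi> \<theta> y = f \<theta> y \<bullet> (matrix_inv (info_matrix f \<xi> \<theta>) *v f \<theta> y)"

text \<open>\<open>x\<close> is a sequence of design points (indexed from 1) that the Wynn-type algorithm can
  produce from the parameters \<open>\<theta> n\<close>, \<open>n \<ge> nst\<close>. The maximizer in each step need not be unique;
  any choice is admitted.\<close>

definition wynn_sequence ::
  "('b \<Rightarrow> 'a \<Rightarrow> real^'p) \<Rightarrow> 'a set \<Rightarrow> 'b set \<Rightarrow> nat \<Rightarrow> (nat \<Rightarrow> 'b) \<Rightarrow> (nat \<Rightarrow> 'a) \<Rightarrow> bool" where
  "wynn_sequence f X \<Theta> nst \<theta> x \<longleftrightarrow>
     nst \<ge> 1 \<and>
     (\<forall>i\<in>{1..nst}. x i \<in> X) \<and>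
     (\<forall>\<tau>\<in>\<Theta>. pos_def_matrix (info_matrix f (empirical_design x nst) \<tau>)) \<and>
     (\<forall>n\<ge>nst. x (Suc n) \<in> X \<and>
        (\<forall>y\<in>X. sensitivity f (empirical_design x n) (\<theta> n) y
               \<le> sensitivity f (empirical_design x n) (\<theta> n) (x (Suc n))))"

end

theory Submission
  imports Defs "HOL-Real_Asymp.Real_Asymp"
begin

text \<open>
  Let \<open>M n\<close> be the information matrix of the \<open>n\<close>-th design at the limit parameter \<open>\<theta>bar\<close>, and \<open>p\<close> its
  dimension. Adding the point with regression vector \<open>g\<close> changes \<open>log det (M n)\<close> by
  \<open>log (1 + g\<^sup>T (M n)\<^sup>-\<^sup>1 g / n) - p log (1 + 1 / n)\<close>, that is, by about (sensitivity of the new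
  point \<open>- p\<close>)\<open> / n\<close>. As the harmonic series diverges, any statement of the form ``if
  \<open>log det (M n) \<le> T\<close>, then the new point has sensitivity at least \<open>p + 2 r\<close>'' with a fixed \<open>r > 0\<close>
  forces \<open>log det (M n)\<close> to be eventually above \<open>T - e\<close>, for each \<open>e > 0\<close> (\<open>drift_eventually_ge\<close>,
  \<open>eventually_det_ge\<close>). If the new point maximized the sensitivity at \<open>\<theta>bar\<close>, every \<open>T\<close> below the
  optimal value would be admissible: the tangent inequality for the concave function \<open>log det\<close>
  (\<open>det_le_exp_trace\<close>) shows that the maximal sensitivity exceeds \<open>p\<close> by at least the gap to the
  optimal log-determinant.

  The new point is a maximizer at \<open>\<theta> n\<close> rather than at \<open>\<theta>bar\<close>. Information matrices at the two parameters
  are uniformly close, but their inverses, and so the sensitivities, need not be close unless the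
  determinants are bounded away from 0. This bound is the heart of the proof
  (\<open>det_M_bounded_below\<close>). It comes from the same drift principle, applied to \<open>M n + \<delta> I\<close> with a
  threshold independent of \<open>\<delta>\<close>: near singularity the maximality of the new point at \<open>\<theta> n\<close>
  implies a large sensitivity at \<open>\<theta>bar\<close> by an argument with quadratic forms that compares no
  inverse matrices (\<open>sensitivity_large_if_nearly_singular\<close>).

  With the bound at hand, sensitivities at \<open>\<theta> n\<close> and \<open>\<theta>bar\<close> differ by a quantity tending to 0, so
  \<open>det (M n)\<close> converges to the maximum (\<open>det_M_eventually_near_optimal\<close>). The information matrices of
  all designs at \<open>\<theta>bar\<close> form a compact convex set, on which the maximizer of the determinant is unique by
  strict concavity (\<open>det_maximizer_unique\<close>); hence \<open>M n\<close> itself converges to it. Replacing \<open>\<theta>bar\<close> by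
  \<open>\<theta>' n\<close> changes the matrices by a null sequence (\<open>M_close\<close>).
\<close>

section \<open>Rank-one updates of the determinant\<close>

lemma outer_product_mult_vec: "outer_product u v *v w = (v \<bullet> w) *\<^sub>R u"
  by (simp add: vec_eq_iff outer_product_def matrix_vector_mult_def inner_vec_def sum_distrib_left
      mult_ac)

lemma matrix_mult_outer_product: "A ** outer_product u v = outer_product (A *v u) v"
  by (simp add: vec_eq_iff outer_product_def matrix_vector_mult_def matrix_matrix_mult_def
      sum_distrib_right mult.assoc)

lemma outer_product_mult_matrix:
  fixes A :: "real^'n^'n"
  shows "outer_product u v ** A = outer_product u (transpose A *v v)"
  by (simp add: vec_eq_iff outer_product_def vector_matrix_mult_def matrix_matrix_mult_def
      sum_distrib_left mult_ac)

lemma matrix_add_rdistrib_real: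
  fixes A B C :: "real^'n^'n"
  shows "(A + B) ** C = A ** C + B ** C"
  by (vector matrix_matrix_mult_def sum.distrib[symmetric] field_simps)

lemma transpose_outer_product: "transpose (outer_product u v) = outer_product v u"
  by (simp add: vec_eq_iff outer_product_def transpose_def mult.commute)

lemma trace_outer_product: "trace (outer_product u v) = u \<bullet> v"
  by (simp add: trace_def outer_product_def inner_vec_def)

lemma matrix_inv_inverse:
  assumes "invertible A"
  shows "A ** matrix_inv A = mat 1" "matrix_inv A ** A = mat 1"
  using someI_ex[OF assms[unfolded invertible_def]] by (auto simp: matrix_inv_def)

lemma symmetric_matrix_inner:
  fixes A :: "real^'n^'n"
  assumes "transpose A = A"
  shows "(A *v u) \<bullet> v = u \<bullet> (A *v v)"
  by (metis assms dot_lmul_matrix transpose_matrix_vector)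

text \<open>Only row \<open>k\<close> differs from the identity, so this is linearity of the determinant in that row
  together with Cramer's rule for the identity matrix.\<close>

lemma det_mat_1_plus_outer_axis:
  fixes w :: "real^'n"
  shows "det (mat 1 + outer_product (axis k 1) w) = 1 + w $ k"
proof -
  have eq: "mat 1 + outer_product (axis k 1) w
      = (\<chi> i. if i = k then axis k 1 + w else axis i (1::real))"
    by (auto simp: vec_eq_iff outer_product_def mat_def axis_def)
  have "det (\<chi> i. if i = k then axis k 1 else axis i (1::real)) = det (mat 1 :: real^'n^'n)"
    by (rule arg_cong[where f = det]) (auto simp: vec_eq_iff mat_def axis_def)
  moreover have "det (\<chi> i. if i = k then w else axis i (1::real)) = w $ k"
  proof -
    have row: "row i (mat 1 :: real^'n^'n) = axis i 1" for i
      by (auto simp: vec_eq_iff mat_def axis_def row_def)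
    show ?thesis
      using cramer_lemma_transpose[of k w "mat 1 :: real^'n^'n"] unfolding row basis_expansion by simp
  qed
  ultimately show ?thesis
    unfolding eq by (subst det_row_add) simp
qed

text \<open>Choose an invertible \<open>P\<close> sending the basis vector \<open>e\<close> to \<open>u\<close>. Then
  \<open>(I + u v\<^sup>T) P = P (I + e (P\<^sup>T v)\<^sup>T)\<close>, which reduces the claim to the case \<open>u = e\<close>.\<close>

lemma det_mat_1_plus_outer:
  fixes u v :: "real^'n"
  shows "det (mat 1 + outer_product u v) = 1 + v \<bullet> u"
proof (cases "u = 0")
  case True
  have "outer_product 0 v = (0 :: real^'n^'n)"
    by (simp add: vec_eq_iff outer_product_def)
  then show ?thesis using True by simp
next
  case False
  obtain k :: 'n where True by blast
  obtain Q :: "real^'n^'n" where Q: "orthogonal_matrix Q" "Q *v axis k 1 = u /\<^sub>R norm u"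
    using orthogonal_matrix_exists_basis[of "u /\<^sub>R norm u" k] False by auto
  define P where "P = norm u *\<^sub>R Q"
  have Pk: "P *v axis k 1 = u"
    using Q(2) False by (simp add: P_def scaleR_matrix_vector_assoc[symmetric])
  have "det P \<noteq> 0"
  proof -
    have "invertible Q"
      using Q(1) by (auto simp: orthogonal_matrix_def invertible_def)
    then have "invertible P"
      unfolding P_def using False by (intro scalar_invertible) auto
    then show ?thesis by (simp add: invertible_det_nz)
  qed
  have "(mat 1 + outer_product u v) ** P = P ** (mat 1 + outer_product (axis k 1) (transpose P *v v))"
    by (simp add: matrix_add_ldistrib matrix_add_rdistrib_real Pk
        outer_product_mult_matrix matrix_mult_outer_product)
  then have "det (mat 1 + outer_product u v) * det P
      = det P * det (mat 1 + outer_product (axis k 1) (transpose P *v v))"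
    by (metis det_mul)
  then have "det (mat 1 + outer_product u v) = 1 + (transpose P *v v) $ k"
    using \<open>det P \<noteq> 0\<close> by (simp add: det_mat_1_plus_outer_axis)
  also have "(transpose P *v v) $ k = (v v* P) \<bullet> axis k 1"
    by (simp add: inner_axis)
  also have "\<dots> = v \<bullet> u"
    unfolding dot_lmul_matrix Pk ..
  finally show ?thesis .
qed

text \<open>Besides giving the growth of the determinant when a design point is added, this expresses the
  sensitivity \<open>v\<^sup>T A\<^sup>-\<^sup>1 v\<close> as \<open>det (A + v v\<^sup>T) / det A - 1\<close>, whose continuity in \<open>A\<close> and \<open>v\<close> is evident.\<close>

lemma matrix_determinant_lemma:
  fixes A :: "real^'n^'n"
  assumes "invertible A"
  shows "det (A + outer_product u v) = det A * (1 + v \<bullet> (matrix_inv A *v u))"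
proof -
  have "A + outer_product u v = A ** (mat 1 + outer_product (matrix_inv A *v u) v)"
    by (simp add: matrix_add_ldistrib matrix_mult_outer_product matrix_vector_mul_assoc
        matrix_inv_inverse(1)[OF assms])
  then show ?thesis by (simp add: det_mul det_mat_1_plus_outer)
qed

section \<open>Diagonalization of symmetric matrices\<close>

lemma congruence_entry:
  fixes A :: "real^'n^'n"
  shows "(transpose P ** A ** P) $ i $ j = column i P \<bullet> (A *v column j P)"
proof -
  have "(transpose P ** A ** P) $ i $ j = (\<Sum>l\<in>UNIV. \<Sum>k\<in>UNIV. P$k$i * A$k$l * P$l$j)"
    by (simp add: matrix_matrix_mult_def transpose_def sum_distrib_right)
  also have "\<dots> = column i P \<bullet> (A *v column j P)"
    by (subst sum.swap) (simp add: inner_vec_def matrix_vector_mult_def column_def sum_distrib_left mult.assoc)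
  finally show ?thesis .
qed

text \<open>The first-order condition at an extremum in derivative-free form: for small \<open>t\<close> of the sign of
  \<open>a\<close> the linear term would dominate.\<close>

lemma linear_term_zero_if_le_quadratic:
  fixes a b :: real
  assumes ineq: "\<And>t. 2 * t * a \<le> t\<^sup>2 * b"
  shows "a = 0"
proof (rule ccontr)
  assume "a \<noteq> 0"
  have "2 * (a / (1 + \<bar>b\<bar>)) * a \<le> (a / (1 + \<bar>b\<bar>))\<^sup>2 * b" by (rule ineq)
  also have "\<dots> \<le> (a / (1 + \<bar>b\<bar>))\<^sup>2 * (1 + \<bar>b\<bar>)"
    by (intro mult_left_mono) auto
  also have "\<dots> = a\<^sup>2 / (1 + \<bar>b\<bar>)"
    by (simp add: power2_eq_square)
  finally have "2 * (a\<^sup>2 / (1 + \<bar>b\<bar>)) \<le> a\<^sup>2 / (1 + \<bar>b\<bar>)"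
    by (simp add: power2_eq_square)
  moreover have "a\<^sup>2 / (1 + \<bar>b\<bar>) > 0" using \<open>a \<noteq> 0\<close> by (intro divide_pos_pos) auto
  ultimately show False by linarith
qed

text \<open>The orthogonal complement of \<open>S\<close> is a nonzero subspace, invariant under \<open>A\<close> because \<open>A\<close> is symmetric
  and \<open>S\<close> consists of eigenvectors. A maximizer of the quadratic form on its unit sphere is the
  eigenvector sought: the first-order condition says that \<open>A v\<close> minus its component along \<open>v\<close> is
  orthogonal to everything in the complement that is orthogonal to \<open>v\<close>, hence to itself.\<close>

lemma exists_orthogonal_eigenvector:
  fixes A :: "real^'n^'n"
  assumes sym: "transpose A = A"
    and eig: "\<And>s. s \<in> S \<Longrightarrow> \<exists>c. A *v s = c *\<^sub>R s"
    and "finite S" "card S < CARD('n)"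
  obtains v c where "norm v = 1" "\<And>s. s \<in> S \<Longrightarrow> s \<bullet> v = 0" "A *v v = c *\<^sub>R v"
proof -
  define U where "U = {v. \<forall>s\<in>S. s \<bullet> v = 0}"
  have "dim (span S) < DIM(real^'n)"
    using dim_le_card'[OF \<open>finite S\<close>] \<open>card S < CARD('n)\<close> by (simp add: dim_span)
  then obtain w where w: "w \<noteq> 0" "\<And>y. y \<in> span (span S) \<Longrightarrow> orthogonal w y"
    using orthogonal_to_subspace_exists[of "span S"] by (metis dim_span)
  have "w /\<^sub>R norm w \<in> U \<inter> sphere 0 1"
    using w by (auto simp: U_def orthogonal_def inner_commute span_base)
  moreover have "closed U"
  proof -
    have "U = (\<Inter>s\<in>S. {v. s \<bullet> v = 0})" by (auto simp: U_def)
    then show ?thesis by (auto intro!: closed_INT closed_hyperplane)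
  qed
  ultimately obtain v where v: "v \<in> U" "norm v = 1"
    and max: "\<And>u. u \<in> U \<Longrightarrow> norm u = 1 \<Longrightarrow> u \<bullet> (A *v u) \<le> v \<bullet> (A *v v)"
    using continuous_attains_sup[of "U \<inter> sphere 0 1" "\<lambda>v. v \<bullet> (A *v v)"]
    by (force intro!: continuous_intros closed_Int_compact)
  define c where "c = v \<bullet> (A *v v)"
  have maxU: "u \<bullet> (A *v u) \<le> c * (u \<bullet> u)" if "u \<in> U" for u
  proof (cases "u = 0")
    case False
    have "u /\<^sub>R norm u \<in> U" using that by (auto simp: U_def)
    then have "(u /\<^sub>R norm u) \<bullet> (A *v (u /\<^sub>R norm u)) \<le> c"
      using max[of "u /\<^sub>R norm u"] False by (simp add: c_def)
    then have "(u \<bullet> (A *v u)) / (norm u)\<^sup>2 \<le> c"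
      by (simp add: matrix_vector_mult_scaleR divide_inverse power2_eq_square mult_ac)
    then show ?thesis using False
      by (simp add: divide_le_eq power2_norm_eq_inner)
  qed auto
  have orth: "u \<bullet> (A *v v) = 0" if "u \<in> U" "u \<bullet> v = 0" for u
  proof -
    define b where "b = c * (u \<bullet> u) - u \<bullet> (A *v u)"
    \<comment> \<open>optimality of \<open>v\<close> along the line \<open>v + t u\<close>\<close>
    have "2 * t * (u \<bullet> (A *v v)) \<le> t\<^sup>2 * b" for t
    proof -
      have "v + t *\<^sub>R u \<in> U" using that v by (auto simp: U_def inner_add_right)
      from maxU[OF this] show ?thesis
        using that(2) v(2) symmetric_matrix_inner[OF sym, of v u]
        by (simp add: b_def inner_add_left inner_add_right matrix_vector_right_distrib inner_commute
            matrix_vector_mult_scaleR c_def[symmetric] norm_eq_1 power2_eq_square algebra_simps)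
    qed
    then show ?thesis by (rule linear_term_zero_if_le_quadratic)
  qed
  have "A *v v = c *\<^sub>R v"
  proof -
    define z where "z = A *v v - c *\<^sub>R v"
    have "s \<bullet> z = 0" if s: "s \<in> S" for s
    proof -
      obtain d where "A *v s = d *\<^sub>R s" using eig s by blast
      moreover have "s \<bullet> v = 0" using v(1) s by (auto simp: U_def)
      ultimately show ?thesis
        using symmetric_matrix_inner[OF sym, of s v] by (simp add: z_def inner_diff_right)
    qed
    then have "z \<in> U" by (auto simp: U_def)
    moreover have zv: "z \<bullet> v = 0"
      using v(2) by (simp add: z_def inner_diff_left c_def norm_eq_1 inner_commute[of "A *v v"])
    ultimately have "z \<bullet> (A *v v) = 0" by (rule orth)
    then have "z \<bullet> z = 0" using zv by (simp add: z_def inner_diff_right)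
    then show ?thesis by (simp add: z_def)
  qed
  then show thesis using that v by (auto simp: U_def)
qed

definition diagonal_matrix :: "('n \<Rightarrow> real) \<Rightarrow> real^'n^'n" where
  "diagonal_matrix d = (\<chi> i j. if i = j then d i else 0)"

lemma diagonal_matrix_mult:
  "diagonal_matrix a ** diagonal_matrix b = diagonal_matrix (\<lambda>i. a i * b i)"
proof -
  have "(\<Sum>k\<in>UNIV. (if i = k then a i else 0) * (if k = j then b k else 0))
      = (\<Sum>k\<in>UNIV. if k = i then (if i = j then a i * b i else 0) else 0)" for i j
    by (rule sum.cong) auto
  then show ?thesis
    by (simp add: vec_eq_iff diagonal_matrix_def matrix_matrix_mult_def)
qed

lemma diagonal_matrix_1: "diagonal_matrix (\<lambda>i. 1) = mat 1"
  by (simp add: diagonal_matrix_def mat_def)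

text \<open>Collecting eigenvectors one at a time until there are as many as the dimension gives the columns
  of \<open>Q\<close>.\<close>

lemma spectral_theorem_symmetric:
  fixes A :: "real^'n^'n"
  assumes sym: "transpose A = A"
  obtains Q d where "orthogonal_matrix Q" "transpose Q ** A ** Q = diagonal_matrix d"
proof -
  have "\<exists>S. finite S \<and> card S = k \<and> (\<forall>s\<in>S. norm s = 1 \<and> (\<exists>c. A *v s = c *\<^sub>R s))
      \<and> pairwise orthogonal S" if "k \<le> CARD('n)" for k
    using that
  proof (induction k)
    case 0
    show ?case by (rule exI[of _ "{}"]) auto
  next
    case (Suc k)
    then obtain S where S: "finite S" "card S = k"
      "\<forall>s\<in>S. norm s = 1 \<and> (\<exists>c. A *v s = c *\<^sub>R s)" "pairwise orthogonal S"
      by auto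
    obtain v c where v: "norm v = 1" "\<And>s. s \<in> S \<Longrightarrow> s \<bullet> v = 0" "A *v v = c *\<^sub>R v"
      using exists_orthogonal_eigenvector[OF sym, of S] S Suc.prems by auto
    have "v \<notin> S" using v(1) v(2)[of v] by (auto simp: norm_eq_1)
    show ?case
    proof (intro exI[of _ "insert v S"] conjI)
      show "finite (insert v S)" "card (insert v S) = Suc k" using S \<open>v \<notin> S\<close> by auto
      show "\<forall>s\<in>insert v S. norm s = 1 \<and> (\<exists>c. A *v s = c *\<^sub>R s)" using S v by auto
      show "pairwise orthogonal (insert v S)"
        using S(4) v(2) by (auto simp: pairwise_insert orthogonal_def inner_commute)
    qed
  qed
  from this[of "CARD('n)"] obtain S where S: "finite S" "card S = CARD('n)"
    "\<And>s. s \<in> S \<Longrightarrow> norm s = 1 \<and> (\<exists>c. A *v s = c *\<^sub>R s)" "pairwise orthogonal S"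
    by auto
  obtain q where q: "bij_betw q (UNIV :: 'n set) S"
    using finite_same_card_bij[of "UNIV :: 'n set" S] S by auto
  have "\<forall>i. \<exists>c. A *v q i = c *\<^sub>R q i"
    using S(3) q by (auto simp: bij_betw_def)
  then obtain d where d: "\<And>i. A *v q i = d i *\<^sub>R q i" by metis
  define Q :: "real^'n^'n" where "Q = (\<chi> i j. q j $ i)"
  have col: "column j Q = q j" for j by (simp add: Q_def column_def vec_eq_iff)
  have nq: "norm (q i) = 1" for i using S(3) q by (auto simp: bij_betw_def)
  have oq: "orthogonal (q i) (q j)" if "i \<noteq> j" for i j
  proof -
    have "q i \<noteq> q j" using q that by (auto simp: bij_betw_def inj_on_def)
    then show ?thesis using S(4) q by (auto simp: pairwise_def bij_betw_def)
  qed
  have "orthogonal_matrix Q"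
    unfolding orthogonal_matrix_orthonormal_columns col using nq oq by auto
  moreover have "transpose Q ** A ** Q = diagonal_matrix d"
    using nq oq by (auto simp: vec_eq_iff congruence_entry col d diagonal_matrix_def orthogonal_def norm_eq_1)
  ultimately show thesis by (rule that)
qed

lemma pos_def_matrix_sym: "pos_def_matrix A \<Longrightarrow> transpose A = A"
  by (simp add: pos_def_matrix_def)

lemma pos_def_matrix_pos: "pos_def_matrix A \<Longrightarrow> v \<noteq> 0 \<Longrightarrow> v \<bullet> (A *v v) > 0"
  by (simp add: pos_def_matrix_def)

lemma pos_def_matrix_nonneg: "pos_def_matrix A \<Longrightarrow> v \<bullet> (A *v v) \<ge> 0"
  using pos_def_matrix_pos[of A v] by (cases "v = 0") auto

lemma pos_def_invertible:
  fixes A :: "real^'n^'n"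
  assumes "pos_def_matrix A"
  shows "invertible A"
proof -
  have "A *v v = 0 \<Longrightarrow> v = 0" for v using pos_def_matrix_pos[OF assms, of v] by force
  then show ?thesis using matrix_left_invertible_ker[of A] invertible_left_inverse by blast
qed

text \<open>A zero of a nonnegative quadratic form is a minimizer, so the first-order condition puts it into
  the kernel of the matrix.\<close>

lemma pos_def_if_psd_det_pos:
  fixes A :: "real^'n^'n"
  assumes sym: "transpose A = A" and psd: "\<And>v. v \<bullet> (A *v v) \<ge> 0" and "det A > 0"
  shows "pos_def_matrix A"
  unfolding pos_def_matrix_def
proof (intro conjI allI impI sym)
  fix v :: "real^'n" assume "v \<noteq> 0"
  have "A *v v \<noteq> 0"
    using \<open>det A > 0\<close> \<open>v \<noteq> 0\<close> invertible_det_nz[of A] matrix_left_invertible_ker[of A]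
      invertible_left_inverse[of A] by auto
  show "v \<bullet> (A *v v) > 0"
  proof (rule ccontr)
    assume "\<not> ?thesis"
    then have v: "v \<bullet> (A *v v) = 0" using psd[of v] by linarith
    define u where "u = A *v v"
    have "2 * t * (u \<bullet> u) \<le> t\<^sup>2 * (u \<bullet> (A *v u))" for t
      using psd[of "v - t *\<^sub>R u"] symmetric_matrix_inner[OF sym, of v u] v
      by (simp add: matrix_vector_mult_diff_distrib matrix_vector_mult_scaleR inner_diff_left
          inner_diff_right u_def[symmetric] power2_eq_square algebra_simps)
    then have "u \<bullet> u = 0" by (rule linear_term_zero_if_le_quadratic)
    then show False using \<open>A *v v \<noteq> 0\<close> by (simp add: u_def)
  qed
qed

text \<open>Rescaling an eigenbasis of \<open>A\<close> turns \<open>A\<close> into the identity; diagonalizing what has become of \<open>B\<close> by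
  an orthogonal matrix leaves the identity in place.\<close>

lemma simultaneous_diagonalization:
  fixes A B :: "real^'n^'n"
  assumes A: "pos_def_matrix A" and B: "transpose B = B"
  obtains P :: "real^'n^'n" and d where "invertible P" "transpose P ** A ** P = mat 1"
    "transpose P ** B ** P = diagonal_matrix d"
proof -
  obtain Q a where Q: "orthogonal_matrix Q" "transpose Q ** A ** Q = diagonal_matrix a"
    using spectral_theorem_symmetric[OF pos_def_matrix_sym[OF A]] .
  have a: "a i > 0" for i
  proof -
    have "norm (column i Q) = 1" using Q(1) by (simp add: orthogonal_matrix_orthonormal_columns)
    then have "column i Q \<noteq> 0" by force
    then have "(transpose Q ** A ** Q) $ i $ i > 0"
      unfolding congruence_entry by (rule pos_def_matrix_pos[OF A])
    then show ?thesis by (simp add: Q(2) diagonal_matrix_def)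
  qed
  define E :: "real^'n^'n" where "E = diagonal_matrix (\<lambda>i. 1 / sqrt (a i))"
  have E: "transpose E = E" by (auto simp: E_def diagonal_matrix_def transpose_def vec_eq_iff)
  define R where "R = Q ** E"
  have "E ** diagonal_matrix a ** E = mat 1"
    using a by (simp add: E_def diagonal_matrix_mult diagonal_matrix_1 less_imp_le less_imp_neq[symmetric])
  then have RA: "transpose R ** A ** R = mat 1"
    unfolding R_def matrix_transpose_mul E Q(2)[symmetric] by (simp add: matrix_mul_assoc)
  have "transpose (transpose R ** B ** R) = transpose R ** B ** R"
    by (simp add: matrix_transpose_mul B matrix_mul_assoc)
  then obtain Q' d where Q': "orthogonal_matrix Q'"
    "transpose Q' ** (transpose R ** B ** R) ** Q' = diagonal_matrix d"
    by (rule spectral_theorem_symmetric)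
  define P where "P = R ** Q'"
  have "transpose P ** A ** P = transpose Q' ** (transpose R ** A ** R) ** Q'"
    by (simp add: P_def matrix_transpose_mul matrix_mul_assoc)
  then have PA: "transpose P ** A ** P = mat 1"
    using Q'(1) by (simp add: RA orthogonal_matrix_def)
  have PB: "transpose P ** B ** P = diagonal_matrix d"
    using Q'(2) by (simp add: P_def matrix_transpose_mul matrix_mul_assoc)
  have "invertible P"
    using PA invertible_left_inverse by blast
  then show thesis using PA PB that by blast
qed

section \<open>Determinants of positive definite matrices\<close>

lemma det_diagonal_matrix: "det (diagonal_matrix d :: real^'n^'n) = (\<Prod>i\<in>UNIV. d i)"
  by (subst det_diagonal) (auto simp: diagonal_matrix_def)

lemma pos_def_det_pos:
  fixes A :: "real^'n^'n"
  assumes "pos_def_matrix A"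
  shows "det A > 0"
proof -
  obtain P :: "real^'n^'n" and d where P: "transpose P ** A ** P = mat 1"
    using simultaneous_diagonalization[OF assms pos_def_matrix_sym[OF assms]] .
  have "det (transpose P ** A ** P) = 1" by (simp add: P)
  then have "(det P)\<^sup>2 * det A = 1"
    by (simp add: det_mul power2_eq_square mult_ac)
  moreover have "(det P)\<^sup>2 \<ge> 0" by simp
  ultimately show ?thesis
    using zero_less_mult_pos[of "(det P)\<^sup>2" "det A"] by (cases "det P = 0") auto
qed

text \<open>In the basis that diagonalizes both matrices, the two quantities that compare \<open>B\<close> with \<open>A\<close>,
  namely \<open>det B / det A\<close> and \<open>trace (A\<^sup>-\<^sup>1 B)\<close>, become the product and the sum of the same numbers \<open>d i\<close>.\<close>

lemma relative_eigenvalues: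
  fixes A B :: "real^'n^'n"
  assumes A: "pos_def_matrix A" and B: "transpose B = B"
  obtains P :: "real^'n^'n" and d where "invertible P" "transpose P ** A ** P = mat 1"
    "transpose P ** B ** P = diagonal_matrix d"
    "det B = det A * (\<Prod>i\<in>UNIV. d i)" "trace (matrix_inv A ** B) = (\<Sum>i\<in>UNIV. d i)"
    "\<forall>i. column i P \<bullet> (A *v column i P) = 1"
    "\<forall>i. d i = column i P \<bullet> (B *v column i P)"
proof -
  obtain P :: "real^'n^'n" and d where P: "invertible P" and PA: "transpose P ** A ** P = mat 1"
    and PB: "transpose P ** B ** P = diagonal_matrix d"
    using simultaneous_diagonalization[OF A B] .
  have "det (transpose P ** A ** P) = 1" by (simp add: PA)
  then have 0: "det P * det P * det A = 1"
    by (simp add: det_mul mult_ac)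
  have "det (transpose P ** B ** P) = (\<Prod>i\<in>UNIV. d i)" by (simp add: PB det_diagonal_matrix)
  then have "det P * det P * det B = (\<Prod>i\<in>UNIV. d i)"
    by (simp add: det_mul mult_ac)
  then have "det A * (\<Prod>i\<in>UNIV. d i) = (det P * det P * det A) * det B"
    by (simp add: mult_ac)
  then have 1: "det B = det A * (\<Prod>i\<in>UNIV. d i)"
    by (simp only: 0 mult_1)
  have "P ** (transpose P ** A) = mat 1"
    using PA matrix_left_right_inverse[of "transpose P ** A" P] by simp
  then have PPA: "(P ** transpose P) ** A = mat 1" by (simp add: matrix_mul_assoc)
  have "P ** transpose P = (P ** transpose P) ** (A ** matrix_inv A)"
    by (simp add: matrix_inv_inverse(1)[OF pos_def_invertible[OF A]])
  also have "\<dots> = matrix_inv A"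
    unfolding matrix_mul_assoc PPA by simp
  finally have inv: "matrix_inv A = P ** transpose P" by simp
  have "trace (matrix_inv A ** B) = trace (P ** (transpose P ** B))"
    by (simp add: inv matrix_mul_assoc)
  also have "\<dots> = trace (diagonal_matrix d)"
    by (subst trace_mul_sym) (simp add: PB)
  also have "\<dots> = (\<Sum>i\<in>UNIV. d i)" by (simp add: trace_def diagonal_matrix_def)
  finally have 2: "trace (matrix_inv A ** B) = (\<Sum>i\<in>UNIV. d i)" .
  have 3: "\<forall>i. column i P \<bullet> (A *v column i P) = 1"
    using PA by (simp add: congruence_entry[symmetric] mat_def)
  have 4: "\<forall>i. d i = column i P \<bullet> (B *v column i P)"
    using PB by (simp add: congruence_entry[symmetric] diagonal_matrix_def)
  from that[OF P PA PB 1 2 3 4] show thesis .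
qed

text \<open>The tangent inequality \<open>log det B \<le> log det A + trace (A\<^sup>-\<^sup>1 (B - A))\<close> of the concave function
  \<open>log det\<close>, in exponential form so that singular \<open>B\<close> are covered. In relative eigenvalues it is the
  product of the inequalities \<open>d \<le> exp (d - 1)\<close>, each strict unless \<open>d = 1\<close>.\<close>

lemma det_le_exp_trace:
  fixes A B :: "real^'n^'n"
  assumes A: "pos_def_matrix A" and B: "transpose B = B" "\<And>v. v \<bullet> (B *v v) \<ge> 0"
  shows "det B \<le> det A * exp (trace (matrix_inv A ** B) - CARD('n))"
    and "B \<noteq> A \<Longrightarrow> det B < det A * exp (trace (matrix_inv A ** B) - CARD('n))"
proof -
  obtain P :: "real^'n^'n" and d where P: "invertible P" and PA: "transpose P ** A ** P = mat 1"
    and PB: "transpose P ** B ** P = diagonal_matrix d"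
    and det: "det B = det A * (\<Prod>i\<in>UNIV. d i)"
    and tr: "trace (matrix_inv A ** B) = (\<Sum>i\<in>UNIV. d i)"
    and "\<forall>i. column i P \<bullet> (A *v column i P) = 1"
    and d: "\<forall>i. d i = column i P \<bullet> (B *v column i P)"
    using relative_eigenvalues[OF A B(1)] .
  have d0: "d i \<ge> 0" for i using B(2) d by simp
  have d1: "d i \<le> exp (d i - 1)" for i using exp_ge_add_one_self[of "d i - 1"] by simp
  have eq: "exp (trace (matrix_inv A ** B) - CARD('n)) = (\<Prod>i\<in>UNIV. exp (d i - 1))"
    by (simp add: tr exp_sum[symmetric] sum_subtractf)
  have detA: "det A > 0" using pos_def_det_pos[OF A] .
  show "det B \<le> det A * exp (trace (matrix_inv A ** B) - CARD('n))"
    unfolding eq det using detA d0 d1 by (intro mult_left_mono prod_mono) auto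
  assume "B \<noteq> A"
  have "\<exists>k. d k \<noteq> 1"
  proof (rule ccontr)
    assume "\<not> ?thesis"
    then have "d = (\<lambda>i. 1)" by auto
    then have "diagonal_matrix d = mat 1"
      by (simp add: diagonal_matrix_def mat_def)
    then have eqAB: "transpose P ** B ** P = transpose P ** A ** P"
      using PA PB by simp
    obtain R where R: "P ** R = mat 1" using P by (auto simp: invertible_def)
    then have R': "transpose R ** transpose P = mat 1"
      by (metis matrix_transpose_mul transpose_mat)
    have "(transpose R ** transpose P) ** C ** (P ** R)
        = transpose R ** (transpose P ** C ** P) ** R" for C :: "real^'n^'n"
      by (simp add: matrix_mul_assoc)
    from this[of A] this[of B] have "B = A" by (simp add: R R' eqAB)
    then show False using \<open>B \<noteq> A\<close> by simp
  qed
  then obtain k where k: "d k \<noteq> 1" by blast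
  have "d k < exp (d k - 1)"
  proof (rule ccontr)
    assume "\<not> ?thesis"
    then have eq: "d k = exp (d k - 1)" using d1[of k] by linarith
    then have "ln (d k) = d k - 1" by (metis ln_exp)
    moreover have "d k > 0" using eq by (metis exp_gt_zero)
    ultimately show False using ln_eq_minus_one k by blast
  qed
  have "(\<Prod>i\<in>UNIV. d i) = d k * (\<Prod>i\<in>UNIV - {k}. d i)" by (simp add: prod.remove)
  also have "\<dots> \<le> d k * (\<Prod>i\<in>UNIV - {k}. exp (d i - 1))"
    using d0 d1 by (intro mult_left_mono prod_mono) auto
  also have "\<dots> < exp (d k - 1) * (\<Prod>i\<in>UNIV - {k}. exp (d i - 1))"
    using \<open>d k < exp (d k - 1)\<close> by (intro mult_strict_right_mono prod_pos) auto
  also have "\<dots> = (\<Prod>i\<in>UNIV. exp (d i - 1))" by (simp add: prod.remove[of UNIV k])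
  finally show "det B < det A * exp (trace (matrix_inv A ** B) - CARD('n))"
    unfolding eq det using detA by simp
qed

lemma det_mono:
  fixes A B :: "real^'n^'n"
  assumes A: "pos_def_matrix A" and B: "transpose B = B"
    and AB: "\<And>v. v \<bullet> (A *v v) \<le> v \<bullet> (B *v v)"
  shows "det A \<le> det B"
proof -
  obtain P :: "real^'n^'n" and d where "invertible P" "transpose P ** A ** P = mat 1"
    "transpose P ** B ** P = diagonal_matrix d"
    and det: "det B = det A * (\<Prod>i\<in>UNIV. d i)"
    and "trace (matrix_inv A ** B) = (\<Sum>i\<in>UNIV. d i)"
    and P1: "\<forall>i. column i P \<bullet> (A *v column i P) = 1"
    and d: "\<forall>i. d i = column i P \<bullet> (B *v column i P)"
    using relative_eigenvalues[OF A B] .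
  have "d i \<ge> 1" for i using AB[of "column i P"] d P1 by simp
  then have "(\<Prod>i\<in>UNIV. d i) \<ge> 1" by (intro prod_ge_1) auto
  then show ?thesis unfolding det using pos_def_det_pos[OF A] by simp
qed

section \<open>A drift lemma for real sequences\<close>

text \<open>The steps \<open>r / n\<close> have a divergent sum, so a bounded sequence cannot stay below \<open>T\<close> and must exceed it
  at arbitrarily late times. After that it drops below \<open>T\<close> only by a single step of size at most
  \<open>c / n\<close>, and rises again from there.\<close>

lemma drift_eventually_ge:
  fixes a :: "nat \<Rightarrow> real"
  assumes step: "\<forall>\<^sub>F n in sequentially. a n - c / real n \<le> a (Suc n)"
    and drift: "\<forall>\<^sub>F n in sequentially. a n \<le> T \<longrightarrow> a n + r / real n \<le> a (Suc n)"
    and bound: "\<forall>\<^sub>F n in sequentially. a n \<le> B"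
    and "r > 0" "e > 0"
  shows "\<forall>\<^sub>F n in sequentially. T - e \<le> a n"
proof -
  have "\<forall>\<^sub>F n in sequentially. c / real n < e"
    using \<open>e > 0\<close> by real_asymp
  then have "\<forall>\<^sub>F n in sequentially. n \<ge> 1 \<and> c / real n < e \<and> a n - c / real n \<le> a (Suc n)
      \<and> (a n \<le> T \<longrightarrow> a n + r / real n \<le> a (Suc n)) \<and> a n \<le> B"
    using step drift bound eventually_ge_at_top[of 1] by eventually_elim auto
  then obtain N where N: "\<And>n. n \<ge> N \<Longrightarrow> n \<ge> 1 \<and> c / real n < e \<and> a n - c / real n \<le> a (Suc n)
      \<and> (a n \<le> T \<longrightarrow> a n + r / real n \<le> a (Suc n)) \<and> a n \<le> B"
    unfolding eventually_sequentially by blast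
  \<comment> \<open>otherwise the partial sums of the harmonic series would be bounded\<close>
  have "\<exists>m\<ge>N. a m > T"
  proof (rule ccontr)
    assume "\<not> ?thesis"
    then have low: "a n \<le> T" if "n \<ge> N" for n using that by force
    have lower: "a N + r * (\<Sum>i<k. 1 / real (i + N)) \<le> a (N + k)" for k
    proof (induction k)
      case (Suc k)
      have "a (N + k) + r / real (N + k) \<le> a (Suc (N + k))"
        using N[of "N + k"] low[of "N + k"] by simp
      with Suc.IH show ?case by (simp add: algebra_simps add.commute)
    qed simp
    have "(\<Sum>i<k. 1 / real (i + N)) \<le> (B - a N) / r" for k
    proof -
      have "r * (\<Sum>i<k. 1 / real (i + N)) \<le> B - a N"
        using lower[of k] N[of "N + k"] by simp
      then show ?thesis using \<open>r > 0\<close> by (simp add: field_simps)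
    qed
    then have "summable (\<lambda>i. 1 / real (i + N))"
      by (intro bounded_imp_summable[where B = "(B - a N) / r"])
        (auto simp: lessThan_Suc_atMost[symmetric] simp del: sum.lessThan_Suc)
    then have "summable (\<lambda>i. 1 / real i)" by (subst (asm) summable_iff_shift)
    then show False using not_summable_harmonic[where 'a = real] by (simp add: divide_inverse)
  qed
  then obtain m where m: "m \<ge> N" "a m > T" by blast
  have "T - e \<le> a n" if "n \<ge> m" for n
    using that
  proof (induction n rule: dec_induct)
    case base
    then show ?case using m \<open>e > 0\<close> by simp
  next
    case (step n)
    then have n: "n \<ge> N" using m by simp
    show ?case
    proof (cases "a n \<le> T")
      case True
      have "r / real n \<ge> 0" using \<open>r > 0\<close> by simp
      then show ?thesis using N[OF n] step.IH True by linarith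
    next
      case False
      then show ?thesis using N[OF n] by linarith
    qed
  qed
  then show ?thesis unfolding eventually_sequentially by blast
qed

text \<open>With sensitivity \<open>p + 2 r\<close> the logarithm of the determinant grows by \<open>2 r / n + O(1 / n\<^sup>2)\<close> in one step;
  half of the main term absorbs the error.\<close>

lemma log_one_plus_step_ge:
  fixes p r :: real
  assumes "p \<ge> 0" "r > 0"
  shows "\<forall>\<^sub>F n in sequentially. r / real n \<le> ln (1 + (p + 2 * r) / real n) - p * ln (1 + 1 / real n)"
proof -
  define D where "D = p + 2 * r"
  have D: "D > 0" using assms by (simp add: D_def)
  have "((\<lambda>n. real n * (ln (1 + D / real n) - p * ln (1 + 1 / real n))) \<longlongrightarrow> D - p) sequentially"
    using D by real_asymp
  moreover have "r < D - p" using assms by (simp add: D_def)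
  ultimately have "\<forall>\<^sub>F n in sequentially. r < real n * (ln (1 + D / real n) - p * ln (1 + 1 / real n))"
    by (rule order_tendstoD(1))
  then show ?thesis
    using eventually_gt_at_top[of 0]
    by eventually_elim (simp add: D_def field_simps)
qed

section \<open>Log-determinants along the recursion\<close>

lemma quadratic_form_outer_product:
  fixes u v :: "real^'n"
  shows "v \<bullet> (outer_product u u *v v) = (u \<bullet> v)\<^sup>2"
  by (simp add: outer_product_mult_vec power2_eq_square inner_commute)

lemma transpose_add: "transpose (A + B) = transpose A + transpose B"
  by (simp add: vec_eq_iff transpose_def)

lemma transpose_scaleR: "transpose (c *\<^sub>R A) = c *\<^sub>R transpose A"
  by (simp add: vec_eq_iff transpose_def)

lemma quadratic_form_scaleR:
  fixes A :: "real^'n^'n"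
  shows "v \<bullet> ((c *\<^sub>R A) *v v) = c * (v \<bullet> (A *v v))"
  by (simp add: scaleR_matrix_vector_assoc[symmetric])

lemma pos_def_matrix_add:
  fixes A B :: "real^'n^'n"
  assumes "pos_def_matrix A" "transpose B = B" "\<And>v. v \<bullet> (B *v v) \<ge> 0"
  shows "pos_def_matrix (A + B)"
  using assms by (auto simp: pos_def_matrix_def transpose_add matrix_vector_mult_add_rdistrib
      inner_add_right intro: add_pos_nonneg)

lemma pos_def_matrix_scaleR:
  fixes A :: "real^'n^'n"
  assumes "pos_def_matrix A" "c > 0"
  shows "pos_def_matrix (c *\<^sub>R A)"
  using assms by (auto simp: pos_def_matrix_def transpose_scaleR quadratic_form_scaleR)

lemma det_scaleR:
  fixes A :: "real^'n^'n"
  shows "det (c *\<^sub>R A) = c ^ CARD('n) * det A"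
proof -
  have "c *\<^sub>R A = (c *\<^sub>R mat 1) ** A"
    by (simp add: scalar_matrix_assoc[symmetric])
  also have "c *\<^sub>R mat 1 = (diagonal_matrix (\<lambda>i. c) :: real^'n^'n)"
    by (simp add: vec_eq_iff diagonal_matrix_def mat_def)
  finally show ?thesis by (simp add: det_mul det_diagonal_matrix)
qed

lemma pos_def_mat_1: "pos_def_matrix (mat 1 :: real^'n^'n)"
  by (simp add: pos_def_matrix_def transpose_mat)

lemma quadratic_form_mat_1: "norm v = 1 \<Longrightarrow> v \<bullet> ((\<delta> *\<^sub>R mat 1) *v v) = \<delta>"
  for v :: "real^'n"
  by (simp add: quadratic_form_scaleR norm_eq_1)

text \<open>The discriminant inequality for the quadratic form at \<open>v - t A\<^sup>-\<^sup>1 g\<close>.\<close>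

lemma pos_def_cauchy_schwarz:
  fixes A :: "real^'n^'n"
  assumes A: "pos_def_matrix A"
  shows "(v \<bullet> g)\<^sup>2 \<le> (v \<bullet> (A *v v)) * (g \<bullet> (matrix_inv A *v g))"
proof (cases "g = 0")
  case False
  define w where "w = matrix_inv A *v g"
  have Aw: "A *v w = g"
    by (simp add: w_def matrix_vector_mul_assoc matrix_inv_inverse(1)[OF pos_def_invertible[OF A]])
  then have "w \<noteq> 0" using False by auto
  define q where "q = g \<bullet> w"
  have q: "w \<bullet> (A *v w) = q" "q > 0"
    using pos_def_matrix_pos[OF A \<open>w \<noteq> 0\<close>] by (simp_all add: q_def Aw inner_commute)
  define t where "t = (v \<bullet> g) / q"
  have "0 \<le> (v - t *\<^sub>R w) \<bullet> (A *v (v - t *\<^sub>R w))" by (rule pos_def_matrix_nonneg[OF A])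
  also have "\<dots> = v \<bullet> (A *v v) - 2 * t * (v \<bullet> g) + t\<^sup>2 * q"
    using symmetric_matrix_inner[OF pos_def_matrix_sym[OF A], of w v]
    by (simp add: matrix_vector_mult_diff_distrib matrix_vector_mult_scaleR inner_diff_left
        inner_diff_right Aw q_def[symmetric] inner_commute power2_eq_square algebra_simps)
  also have "\<dots> = v \<bullet> (A *v v) - (v \<bullet> g)\<^sup>2 / q"
    using q(2) by (simp add: t_def power2_eq_square field_simps)
  finally show ?thesis
    using q(2) by (simp add: q_def w_def field_simps)
qed simp

lemma pos_def_inverse_nonneg:
  fixes A :: "real^'n^'n"
  assumes "pos_def_matrix A"
  shows "g \<bullet> (matrix_inv A *v g) \<ge> 0"
proof (cases "g = 0")
  case False
  then have "g \<bullet> (A *v g) > 0" by (rule pos_def_matrix_pos[OF assms])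
  moreover have "0 \<le> (g \<bullet> (A *v g)) * (g \<bullet> (matrix_inv A *v g))"
    using pos_def_cauchy_schwarz[OF assms, of g g] by (rule order_trans[OF zero_le_power2])
  ultimately show ?thesis by (simp add: zero_le_mult_iff)
qed simp

text \<open>One step of the algorithm shrinks the old matrix by the factor \<open>n / (n + 1)\<close> and adds a rank-one
  term, which the matrix determinant lemma accounts for. The regularizing summand
  \<open>\<delta> / (n + 1) I\<close> can only enlarge the determinant.\<close>

lemma det_recursion_step_ge:
  fixes N :: "real^'n^'n"
  assumes N: "pos_def_matrix N" and "n \<ge> 1" "\<delta> \<ge> 0"
    and N': "N' = (real n / real (Suc n)) *\<^sub>R N
      + (1 / real (Suc n)) *\<^sub>R (outer_product g g + \<delta> *\<^sub>R mat 1)"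
  shows "pos_def_matrix N'"
    and "ln (det N') \<ge> ln (det N) + ln (1 + (g \<bullet> (matrix_inv N *v g)) / real n)
      - real CARD('n) * ln (1 + 1 / real n)"
proof -
  define s where "s = real n / real (Suc n)"
  have s: "s > 0" using \<open>n \<ge> 1\<close> by (simp add: s_def)
  define D where "D = g \<bullet> (matrix_inv N *v g)"
  have D: "D \<ge> 0" unfolding D_def by (rule pos_def_inverse_nonneg[OF N])
  define A where "A = N + outer_product (g /\<^sub>R real n) g"
  have outer: "outer_product (g /\<^sub>R real n) g = (1 / real n) *\<^sub>R outer_product g g"
    by (simp add: outer_product_def vec_eq_iff divide_inverse)
  have A: "pos_def_matrix A"
    unfolding A_def outer using N
    by (rule pos_def_matrix_add)
      (simp_all add: transpose_scaleR transpose_outer_product quadratic_form_scaleR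
        quadratic_form_outer_product)
  have detA: "det A = det N * (1 + D / real n)"
    by (simp add: A_def D_def matrix_determinant_lemma[OF pos_def_invertible[OF N]]
        matrix_vector_mult_scaleR divide_inverse)
  have N'_eq: "N' = s *\<^sub>R A + (\<delta> / real (Suc n)) *\<^sub>R mat 1"
    using \<open>n \<ge> 1\<close> by (simp add: N' A_def s_def outer scaleR_add_right)
  have sA: "pos_def_matrix (s *\<^sub>R A)" using A s by (rule pos_def_matrix_scaleR)
  show pd: "pos_def_matrix N'"
    unfolding N'_eq using sA \<open>\<delta> \<ge> 0\<close>
    by (intro pos_def_matrix_add) (auto simp: transpose_scaleR transpose_mat quadratic_form_scaleR)
  have "det (s *\<^sub>R A) \<le> det N'"
    using sA pos_def_matrix_sym[OF pd] \<open>\<delta> \<ge> 0\<close>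
    by (rule_tac det_mono) (auto simp: N'_eq matrix_vector_mult_add_rdistrib inner_add_right quadratic_form_scaleR)
  then have "ln (det (s *\<^sub>R A)) \<le> ln (det N')"
    using pos_def_det_pos[OF sA] by simp
  moreover have "1 + D / real n > 0" using D by (simp add: add_pos_nonneg)
  moreover have "det N > 0" by (rule pos_def_det_pos[OF N])
  ultimately have "real CARD('n) * ln s + (ln (det N) + ln (1 + D / real n)) \<le> ln (det N')"
    using s by (simp add: det_scaleR detA ln_mult ln_realpow)
  moreover have "ln s = - ln (1 + 1 / real n)"
  proof -
    have "s = inverse (1 + 1 / real n)" using \<open>n \<ge> 1\<close> by (simp add: s_def field_simps)
    then show ?thesis using \<open>n \<ge> 1\<close> by (simp add: ln_inverse add_pos_nonneg)
  qed
  ultimately show "ln (det N') \<ge> ln (det N) + ln (1 + (g \<bullet> (matrix_inv N *v g)) / real n)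
      - real CARD('n) * ln (1 + 1 / real n)"
    by (simp add: D_def)
qed

text \<open>The drift lemma applied to the log-determinant. It is stated for the regularized matrices
  \<open>M n + \<delta> I\<close>: positive \<open>\<delta>\<close> serves to show that the matrices stay away from singularity, \<open>\<delta> = 0\<close> to
  show that they become nearly optimal.\<close>

lemma eventually_det_ge:
  fixes M :: "nat \<Rightarrow> real^'n^'n"
  assumes rec: "\<And>n. n \<ge> m \<Longrightarrow> M (Suc n) = (real n / real (Suc n)) *\<^sub>R M n
      + (1 / real (Suc n)) *\<^sub>R outer_product (g n) (g n)"
    and pd: "\<And>n. n \<ge> m \<Longrightarrow> pos_def_matrix (M n + \<delta> *\<^sub>R mat 1)"
    and "\<delta> \<ge> 0"
    and bound: "\<And>n. n \<ge> m \<Longrightarrow> det (M n + \<delta> *\<^sub>R mat 1) \<le> B"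
    and drift: "\<forall>\<^sub>F n in sequentially. det (M n + \<delta> *\<^sub>R mat 1) \<le> \<kappa> \<longrightarrow>
      real CARD('n) + 2 * r \<le> g n \<bullet> (matrix_inv (M n + \<delta> *\<^sub>R mat 1) *v g n)"
    and "r > 0" "0 < \<kappa>'" "\<kappa>' < \<kappa>"
  shows "\<forall>\<^sub>F n in sequentially. \<kappa>' \<le> det (M n + \<delta> *\<^sub>R mat 1)"
proof -
  define N where "N n = M n + \<delta> *\<^sub>R mat 1" for n
  define D where "D n = g n \<bullet> (matrix_inv (N n) *v g n)" for n
  define p where "p = real CARD('n)"
  have det_pos: "det (N n) > 0" if "n \<ge> m" for n
    using pos_def_det_pos[OF pd[OF that]] by (simp add: N_def)
  have N_rec: "N (Suc n) = (real n / real (Suc n)) *\<^sub>R N n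
      + (1 / real (Suc n)) *\<^sub>R (outer_product (g n) (g n) + \<delta> *\<^sub>R mat 1)" if "n \<ge> m" for n
  proof -
    have "1 + real n \<noteq> 0" using of_nat_0_le_iff[of n, where 'a = real] by linarith
    then have "\<delta> = real n * \<delta> / (1 + real n) + \<delta> / (1 + real n)"
      by (simp add: add_divide_distrib[symmetric] eq_divide_eq algebra_simps)
    then have "(real n * \<delta> / (1 + real n)) *\<^sub>R (mat 1 :: real^'n^'n) + (\<delta> / (1 + real n)) *\<^sub>R mat 1
        = \<delta> *\<^sub>R mat 1"
      by (metis scaleR_left_distrib)
    then show ?thesis using rec[OF that]
      by (simp add: N_def scaleR_add_right)
  qed
  have D0: "D n \<ge> 0" if "n \<ge> m" for n
    unfolding D_def N_def by (rule pos_def_inverse_nonneg[OF pd[OF that]])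
  have incr: "ln (det (N (Suc n))) \<ge> ln (det (N n)) + ln (1 + D n / real n) - p * ln (1 + 1 / real n)"
    if "n \<ge> m" "n \<ge> 1" for n
    using det_recursion_step_ge(2)[OF pd[OF that(1), folded N_def] that(2) \<open>\<delta> \<ge> 0\<close> N_rec[OF that(1)]]
    by (simp add: D_def p_def)
  have "\<forall>\<^sub>F n in sequentially. ln \<kappa> - (ln \<kappa> - ln \<kappa>') \<le> ln (det (N n))"
  proof (rule drift_eventually_ge[where c = p and r = r and B = "ln B"])
    show "\<forall>\<^sub>F n in sequentially. ln (det (N n)) - p / real n \<le> ln (det (N (Suc n)))"
      using eventually_ge_at_top[of m] eventually_ge_at_top[of 1]
    proof eventually_elim
      case (elim n)
      have "ln (1 + D n / real n) \<ge> 0" using D0 elim by (intro ln_ge_zero) auto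
      moreover have "ln (1 + 1 / real n) \<le> 1 / real n" by (intro ln_add_one_self_le_self) auto
      then have "p * ln (1 + 1 / real n) \<le> p / real n"
        using mult_left_mono[of "ln (1 + 1 / real n)" "1 / real n" p] by (simp add: p_def)
      ultimately show ?case using incr[OF elim] by linarith
    qed
    have "\<forall>\<^sub>F n in sequentially. r / real n \<le> ln (1 + (p + 2 * r) / real n) - p * ln (1 + 1 / real n)"
      using \<open>r > 0\<close> by (intro log_one_plus_step_ge) (auto simp: p_def)
    then show "\<forall>\<^sub>F n in sequentially. ln (det (N n)) \<le> ln \<kappa> \<longrightarrow>
        ln (det (N n)) + r / real n \<le> ln (det (N (Suc n)))"
      using drift eventually_ge_at_top[of m] eventually_ge_at_top[of 1]
    proof eventually_elim
      case (elim n)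
      show ?case
      proof
        assume "ln (det (N n)) \<le> ln \<kappa>"
        then have "det (N n) \<le> \<kappa>" using det_pos elim \<open>0 < \<kappa>'\<close> \<open>\<kappa>' < \<kappa>\<close> by simp
        then have "p + 2 * r \<le> D n" using elim by (simp add: N_def D_def p_def)
        then have "(p + 2 * r) / real n \<le> D n / real n" by (simp add: divide_right_mono)
        moreover have "(p + 2 * r) / real n \<ge> 0" using \<open>r > 0\<close> by (simp add: p_def)
        ultimately have "ln (1 + (p + 2 * r) / real n) \<le> ln (1 + D n / real n)" by simp
        then show "ln (det (N n)) + r / real n \<le> ln (det (N (Suc n)))"
          using incr[of n] elim by linarith
      qed
    qed
    show "\<forall>\<^sub>F n in sequentially. ln (det (N n)) \<le> ln B"
      using eventually_ge_at_top[of m]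
    proof eventually_elim
      case (elim n)
      then show ?case using det_pos[of n] bound[of n, folded N_def] by simp
    qed
    show "r > 0" by fact
    show "ln \<kappa> - ln \<kappa>' > 0" using \<open>0 < \<kappa>'\<close> \<open>\<kappa>' < \<kappa>\<close> by simp
  qed
  then show ?thesis
    using eventually_ge_at_top[of m]
  proof eventually_elim
    case (elim n)
    then have "ln \<kappa>' \<le> ln (det (N n))" by simp
    then show ?case using det_pos[of n] elim \<open>0 < \<kappa>'\<close> by (simp add: N_def)
  qed
qed

section \<open>Sensitivity at a nearly singular information matrix\<close>

text \<open>Otherwise \<open>N\<close> would dominate \<open>\<mu> I\<close> and have determinant at least \<open>\<mu>\<close> to the power of the dimension.\<close>

lemma exists_unit_vector_small_quadratic_form:
  fixes N :: "real^'n^'n"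
  assumes N: "pos_def_matrix N" and "\<mu> > 0" "det N < \<mu> ^ CARD('n)"
  shows "\<exists>v. norm v = 1 \<and> v \<bullet> (N *v v) \<le> \<mu>"
proof (rule ccontr)
  assume "\<not> ?thesis"
  then have unit: "\<mu> \<le> v \<bullet> (N *v v)" if "norm v = 1" for v using that by force
  have "v \<bullet> ((\<mu> *\<^sub>R mat 1) *v v) \<le> v \<bullet> (N *v v)" for v
  proof (cases "v = 0")
    case False
    have "\<mu> \<le> (v /\<^sub>R norm v) \<bullet> (N *v (v /\<^sub>R norm v))" using False by (intro unit) simp
    also have "\<dots> = (v \<bullet> (N *v v)) / (v \<bullet> v)"
      by (simp add: matrix_vector_mult_scaleR power2_norm_eq_inner[symmetric] power2_eq_square field_simps)
    finally show ?thesis using False by (simp add: quadratic_form_scaleR field_simps)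
  qed simp
  then have "det (\<mu> *\<^sub>R mat 1 :: real^'n^'n) \<le> det N"
    using \<open>\<mu> > 0\<close> pos_def_matrix_sym[OF N] by (intro det_mono pos_def_matrix_scaleR pos_def_mat_1)
  then show False using assms(3) by (simp add: det_scaleR)
qed

lemma exists_min_quadratic_form:
  fixes A :: "real^'n^'n"
  obtains v where "norm v = 1" "\<And>w. norm w = 1 \<Longrightarrow> v \<bullet> (A *v v) \<le> w \<bullet> (A *v w)"
proof -
  have "axis undefined 1 \<in> sphere (0 :: real^'n) 1" by simp
  then obtain v where "v \<in> sphere (0 :: real^'n) 1" "\<And>w. w \<in> sphere 0 1 \<Longrightarrow> v \<bullet> (A *v v) \<le> w \<bullet> (A *v w)"
    using continuous_attains_inf[of "sphere (0 :: real^'n) 1" "\<lambda>v. v \<bullet> (A *v v)"]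
    by (force intro!: continuous_intros)
  then show thesis using that by auto
qed

text \<open>This step replaces a comparison of inverse matrices, which is not available before a lower bound
  on the eigenvalues is known. Here \<open>A\<close> is the information matrix at the current parameter, for which
  \<open>g\<close> is a most sensitive regression vector, whereas \<open>N\<close> and \<open>g'\<close> are their counterparts at the limit
  parameter, \<open>N\<close> being regularized by at most \<open>\<mu>\<close>. A direction \<open>v\<close> minimizing the form of \<open>A\<close> is seen by
  some regression vector, so the Cauchy-Schwarz inequality makes the sensitivity of \<open>g\<close> large. Hence the
  direction \<open>u\<close> of \<open>A\<^sup>-\<^sup>1 g\<close> is nearly degenerate for \<open>A\<close> and is also seen by \<open>g\<close>: in fact
  \<open>(u \<bullet> g)\<^sup>2\<close> is the product of the sensitivity of \<open>g\<close> and the form of \<open>A\<close> at \<open>u\<close>. Both properties of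
  \<open>u\<close> survive the passage to \<open>N\<close> and \<open>g'\<close>, and Cauchy-Schwarz for \<open>N\<close> turns them back into a lower bound
  on the sensitivity. The bound does not involve the smallest eigenvalue of \<open>A\<close>.\<close>

lemma sensitivity_large_if_nearly_singular:
  fixes A N :: "real^'n^'n"
  assumes A: "pos_def_matrix A" and N: "pos_def_matrix N"
    and AN: "\<And>w. norm w = 1 \<Longrightarrow> w \<bullet> (A *v w) \<le> w \<bullet> (N *v w) + \<mu>"
    and NA: "\<And>w. norm w = 1 \<Longrightarrow> w \<bullet> (N *v w) \<le> w \<bullet> (A *v w) + 2 * \<mu>"
    and small: "norm v\<^sub>0 = 1" "v\<^sub>0 \<bullet> (N *v v\<^sub>0) \<le> \<mu>"
    and "\<mu> > 0" "b > 0" "norm g \<le> B" "norm (g - g') \<le> b"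
    and dir: "\<And>v. norm v = 1 \<Longrightarrow>
      \<exists>h. 2 * b \<le> \<bar>v \<bullet> h\<bar> \<and> h \<bullet> (matrix_inv A *v h) \<le> g \<bullet> (matrix_inv A *v g)"
  shows "b\<^sup>2 / (\<mu> * (B\<^sup>2 / (2 * b\<^sup>2) + 2)) \<le> g' \<bullet> (matrix_inv N *v g')"
proof -
  obtain v where v: "norm v = 1" "\<And>w. norm w = 1 \<Longrightarrow> v \<bullet> (A *v v) \<le> w \<bullet> (A *v w)"
    using exists_min_quadratic_form[of A] by blast
  define s where "s = v \<bullet> (A *v v)"
  have "v \<noteq> 0" using v(1) by auto
  then have s: "0 < s" "s \<le> 2 * \<mu>"
    using pos_def_matrix_pos[OF A, of v] v(2)[OF small(1)] AN[OF small(1)] small(2)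
    by (auto simp: s_def)
  define w where "w = matrix_inv A *v g"
  have Aw: "A *v w = g"
    by (simp add: w_def matrix_vector_mul_assoc matrix_inv_inverse(1)[OF pos_def_invertible[OF A]])
  define d where "d = g \<bullet> w"
  have sd: "(2 * b)\<^sup>2 \<le> s * d"
  proof -
    obtain h where h: "2 * b \<le> \<bar>v \<bullet> h\<bar>" "h \<bullet> (matrix_inv A *v h) \<le> d"
      using dir[OF v(1)] by (auto simp: d_def w_def)
    have "(2 * b)\<^sup>2 \<le> \<bar>v \<bullet> h\<bar>\<^sup>2" using h(1) \<open>b > 0\<close> by (intro power_mono) auto
    then have "(2 * b)\<^sup>2 \<le> (v \<bullet> h)\<^sup>2" by simp
    also have "\<dots> \<le> s * (h \<bullet> (matrix_inv A *v h))"
      unfolding s_def by (rule pos_def_cauchy_schwarz[OF A])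
    also have "\<dots> \<le> s * d" using h(2) s by simp
    finally show ?thesis .
  qed
  have "(2 * b)\<^sup>2 > 0" using \<open>b > 0\<close> by simp
  then have "s * d > 0" using sd by linarith
  then have "d > 0" using s(1) by (simp add: zero_less_mult_iff)
  then have "w \<noteq> 0" by (auto simp: d_def)
  define u where "u = w /\<^sub>R norm w"
  have u: "norm u = 1" using \<open>w \<noteq> 0\<close> by (simp add: u_def)
  have ug: "u \<bullet> g = d / norm w" by (simp add: u_def d_def inner_commute divide_inverse)
  have uAu: "u \<bullet> (A *v u) = d / (norm w)\<^sup>2"
    by (simp add: u_def matrix_vector_mult_scaleR Aw d_def inner_commute divide_inverse power2_eq_square)
  \<comment> \<open>equality in the Cauchy-Schwarz inequality for \<open>A\<close>: the direction \<open>A\<^sup>-\<^sup>1 g\<close> is the extremal one\<close>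
  have ug2: "(u \<bullet> g)\<^sup>2 = d * (u \<bullet> (A *v u))"
    by (simp add: ug uAu power2_eq_square)
  have "s \<le> u \<bullet> (A *v u)" using v(2)[OF u] by (simp add: s_def)
  then have "(2 * b)\<^sup>2 \<le> (u \<bullet> g)\<^sup>2"
    using sd \<open>d > 0\<close> unfolding ug2 by (metis mult.commute mult_left_mono less_imp_le order_trans)
  moreover have "u \<bullet> g \<ge> 0" using \<open>d > 0\<close> by (simp add: ug)
  ultimately have "2 * b \<le> u \<bullet> g" by (rule power2_le_imp_le)
  moreover have "\<bar>u \<bullet> (g - g')\<bar> \<le> b"
    using Cauchy_Schwarz_ineq2[of u "g - g'"] u \<open>norm (g - g') \<le> b\<close> by simp
  ultimately have ug': "b \<le> u \<bullet> g'" by (simp add: inner_diff_right)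
  have "\<bar>u \<bullet> g\<bar> \<le> B" using Cauchy_Schwarz_ineq2[of u g] u \<open>norm g \<le> B\<close> by simp
  then have "(u \<bullet> g)\<^sup>2 \<le> B\<^sup>2"
    by (metis abs_ge_zero order_trans abs_of_nonneg abs_le_square_iff)
  then have "u \<bullet> (A *v u) \<le> B\<^sup>2 / d"
    using \<open>d > 0\<close> by (simp add: ug2 field_simps)
  also have "\<dots> \<le> \<mu> * (B\<^sup>2 / (2 * b\<^sup>2))"
  proof -
    have "4 * b\<^sup>2 \<le> 2 * \<mu> * d"
      using sd mult_right_mono[OF s(2) less_imp_le[OF \<open>d > 0\<close>]] by (simp add: power_mult_distrib)
    then have "B\<^sup>2 * (4 * b\<^sup>2) \<le> B\<^sup>2 * (2 * \<mu> * d)" by (intro mult_left_mono) auto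
    then show ?thesis using \<open>d > 0\<close> \<open>b > 0\<close> by (simp add: field_simps)
  qed
  finally have uNu: "u \<bullet> (N *v u) \<le> \<mu> * (B\<^sup>2 / (2 * b\<^sup>2) + 2)"
    using NA[OF u] by (simp add: algebra_simps)
  define D where "D = g' \<bullet> (matrix_inv N *v g')"
  have "b\<^sup>2 \<le> (u \<bullet> g')\<^sup>2" using ug' \<open>b > 0\<close> by (intro power_mono) auto
  also have "\<dots> \<le> (u \<bullet> (N *v u)) * D"
    unfolding D_def by (rule pos_def_cauchy_schwarz[OF N])
  finally have b2: "b\<^sup>2 \<le> (u \<bullet> (N *v u)) * D" .
  have "u \<noteq> 0" using u by auto
  then have "u \<bullet> (N *v u) > 0" by (rule pos_def_matrix_pos[OF N])
  moreover have "(u \<bullet> (N *v u)) * D > 0" using b2 \<open>b > 0\<close> by (smt (verit) zero_less_power)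
  ultimately have "D > 0" by (simp add: zero_less_mult_iff)
  then have "b\<^sup>2 \<le> \<mu> * (B\<^sup>2 / (2 * b\<^sup>2) + 2) * D"
    using b2 mult_right_mono[OF uNu, of D] by linarith
  moreover have "\<mu> * (B\<^sup>2 / (2 * b\<^sup>2) + 2) > 0"
    using \<open>\<mu> > 0\<close> by (intro mult_pos_pos add_nonneg_pos) auto
  ultimately show ?thesis unfolding D_def[symmetric] by (simp add: pos_divide_le_eq mult.commute)
qed

lemma continuous_on_det [continuous_intros]:
  fixes F :: "'c::topological_space \<Rightarrow> real^'n^'n"
  assumes "continuous_on S F"
  shows "continuous_on S (\<lambda>x. det (F x))"
  unfolding det_def using assms by (intro continuous_intros) auto

section \<open>Information matrices of designs\<close>

lemma info_matrix_eq_expectation: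
  assumes "finite (set_pmf \<xi>)"
  shows "info_matrix f \<xi> \<tau> = measure_pmf.expectation \<xi> (\<lambda>y. outer_product (f \<tau> y) (f \<tau> y))"
  unfolding info_matrix_def by (rule integral_measure_pmf[symmetric, OF assms])

lemma info_matrix_empirical_design:
  assumes "n \<ge> 1"
  shows "info_matrix f (empirical_design x n) \<tau>
    = (1 / real n) *\<^sub>R (\<Sum>i=1..n. outer_product (f \<tau> (x i)) (f \<tau> (x i)))"
proof -
  have ne: "{1..n} \<noteq> {}" using assms by simp
  have "finite (set_pmf (empirical_design x n))"
    using ne by (simp add: empirical_design_def)
  then have "info_matrix f (empirical_design x n) \<tau>
      = measure_pmf.expectation (pmf_of_set {1..n}) (\<lambda>i. outer_product (f \<tau> (x i)) (f \<tau> (x i)))"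
    by (simp add: info_matrix_eq_expectation empirical_design_def)
  also have "\<dots> = (\<Sum>i=1..n. pmf (pmf_of_set {1..n}) i *\<^sub>R outer_product (f \<tau> (x i)) (f \<tau> (x i)))"
    using ne by (intro integral_measure_pmf) auto
  also have "\<dots> = (\<Sum>i=1..n. (1 / real n) *\<^sub>R outer_product (f \<tau> (x i)) (f \<tau> (x i)))"
    using ne by (intro sum.cong) auto
  finally show ?thesis by (simp add: scaleR_sum_right)
qed

lemma empirical_info_matrix_Suc:
  assumes "n \<ge> 1"
  shows "info_matrix f (empirical_design x (Suc n)) \<tau>
    = (real n / real (Suc n)) *\<^sub>R info_matrix f (empirical_design x n) \<tau>
      + (1 / real (Suc n)) *\<^sub>R outer_product (f \<tau> (x (Suc n))) (f \<tau> (x (Suc n)))"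
  using assms by (simp add: info_matrix_empirical_design scaleR_add_right)

lemma empirical_design_is_design:
  assumes "n \<ge> 1" "\<And>i. 1 \<le> i \<Longrightarrow> i \<le> n \<Longrightarrow> x i \<in> X"
  shows "is_design X (empirical_design x n)"
  using assms by (auto simp: is_design_def empirical_design_def)

lemma info_matrix_in_convex_hull:
  assumes "is_design X \<xi>"
  shows "info_matrix f \<xi> \<tau> \<in> convex hull ((\<lambda>y. outer_product (f \<tau> y) (f \<tau> y)) ` X)"
  unfolding info_matrix_def using assms
  by (intro convex_sum convex_convex_hull hull_inc) (auto simp: is_design_def sum_pmf_eq_1)

text \<open>Together with the preceding lemma: information matrices of designs are exactly the points of a
  convex hull. Since convex hulls of compact sets in Euclidean space are compact, this makes
  optimal designs exist.\<close>

lemma convex_hull_imp_info_matrix: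
  assumes "M \<in> convex hull ((\<lambda>y. outer_product (f \<tau> y) (f \<tau> y)) ` X)"
  obtains \<xi> where "is_design X \<xi>" "info_matrix f \<xi> \<tau> = M"
proof -
  obtain S u where S: "finite S" "S \<subseteq> (\<lambda>y. outer_product (f \<tau> y) (f \<tau> y)) ` X"
    and u: "\<forall>v\<in>S. 0 \<le> u v" "sum u S = 1" and M: "(\<Sum>v\<in>S. u v *\<^sub>R v) = M"
    using assms unfolding convex_hull_explicit by blast
  have "\<forall>v\<in>S. \<exists>y\<in>X. v = outer_product (f \<tau> y) (f \<tau> y)" using S(2) by blast
  then obtain g where g: "\<And>v. v \<in> S \<Longrightarrow> g v \<in> X \<and> outer_product (f \<tau> (g v)) (f \<tau> (g v)) = v"
    by metis
  define w where "w v = (if v \<in> S then u v else 0)" for v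
  have w0: "w v \<ge> 0" for v using u by (auto simp: w_def)
  have "(\<integral>\<^sup>+ v. ennreal (w v) \<partial>count_space UNIV) = (\<Sum>v\<in>S. ennreal (w v))"
    by (rule nn_integral_count_space'[OF S(1)]) (auto simp: w_def)
  also have "\<dots> = ennreal (\<Sum>v\<in>S. w v)" using w0 by (intro sum_ennreal) auto
  also have "(\<Sum>v\<in>S. w v) = 1" using u(2) by (simp add: w_def)
  finally have w1: "(\<integral>\<^sup>+ v. ennreal (w v) \<partial>count_space UNIV) = 1" by simp
  define P where "P = embed_pmf w"
  have P: "pmf P v = w v" for v
    unfolding P_def by (rule pmf_embed_pmf[OF w0 w1])
  then have setP: "set_pmf P \<subseteq> S" by (auto simp: set_pmf_eq w_def split: if_splits)
  define \<xi> where "\<xi> = map_pmf g P"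
  have fin: "finite (set_pmf \<xi>)" using setP S(1) by (auto simp: \<xi>_def intro: finite_subset)
  have "is_design X \<xi>" using fin setP g by (auto simp: is_design_def \<xi>_def)
  moreover have "info_matrix f \<xi> \<tau>
      = measure_pmf.expectation P (\<lambda>v. outer_product (f \<tau> (g v)) (f \<tau> (g v)))"
    unfolding info_matrix_eq_expectation[OF fin] by (simp add: \<xi>_def)
  moreover have "\<dots> = (\<Sum>v\<in>S. pmf P v *\<^sub>R outer_product (f \<tau> (g v)) (f \<tau> (g v)))"
    using setP by (intro integral_measure_pmf S(1)) auto
  moreover have "\<dots> = M" unfolding M[symmetric]
    by (intro sum.cong) (auto simp: P w_def g)
  ultimately show thesis using that by simp
qed

text \<open>Applied to the trace of a product with an inverse matrix, this yields a point of sensitivity at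
  least the average; applied to a quadratic form, a point that sees a given direction.\<close>

lemma linear_le_on_convex_hull_image:
  assumes L: "linear (L :: 'c::real_vector \<Rightarrow> real)" and B: "B \<in> convex hull (g ` X)"
  shows "\<exists>y\<in>X. L B \<le> L (g y)"
proof (rule ccontr)
  assume "\<not> ?thesis"
  then have "g ` X \<subseteq> {C. L C < L B}" by auto
  moreover have "convex (L -` {..<L B})"
    by (intro convex_linear_vimage[OF L]) (simp add: convex_real_interval)
  then have "convex {C. L C < L B}" by (simp add: vimage_def)
  ultimately have "convex hull (g ` X) \<subseteq> {C. L C < L B}" by (rule hull_minimal)
  then show False using B by auto
qed

lemma linear_quadratic_form:
  fixes v :: "real^'n"
  shows "linear (\<lambda>B. v \<bullet> (B *v v))"
  by (rule linearI) (simp_all add: matrix_vector_mult_add_rdistrib inner_add_right quadratic_form_scaleR)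

lemma linear_trace_mult:
  fixes S :: "real^'n^'n"
  shows "linear (\<lambda>B. trace (S ** B))"
proof (rule linearI)
  fix B C :: "real^'n^'n" and c :: real
  show "trace (S ** (B + C)) = trace (S ** B) + trace (S ** C)"
    by (simp add: matrix_add_ldistrib trace_add)
  show "trace (S ** (c *\<^sub>R B)) = c *\<^sub>R trace (S ** B)"
    by (simp add: trace_def matrix_matrix_mult_def sum_distrib_left mult_ac)
qed

lemma trace_mult_outer_product:
  fixes S :: "real^'n^'n"
  shows "trace (S ** outer_product v v) = v \<bullet> (S *v v)"
  by (simp add: matrix_mult_outer_product trace_outer_product inner_commute)

lemma convex_hull_outer_products_psd:
  fixes g :: "'a \<Rightarrow> real^'n"
  assumes "B \<in> convex hull ((\<lambda>y. outer_product (g y) (g y)) ` X)"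
  shows "transpose B = B" "v \<bullet> (B *v v) \<ge> 0"
proof -
  have "convex {B :: real^'n^'n. transpose B = B}"
    by (rule convexI) (simp add: transpose_add transpose_scaleR)
  then have "convex hull ((\<lambda>y. outer_product (g y) (g y)) ` X) \<subseteq> {B. transpose B = B}"
    by (intro hull_minimal) (auto simp: transpose_outer_product)
  then show "transpose B = B" using assms by auto
  have "convex ((\<lambda>B :: real^'n^'n. v \<bullet> (B *v v)) -` {0..})"
    by (intro convex_linear_vimage[OF linear_quadratic_form]) (simp add: convex_real_interval)
  then have "convex hull ((\<lambda>y. outer_product (g y) (g y)) ` X) \<subseteq> (\<lambda>B. v \<bullet> (B *v v)) -` {0..}"
    by (intro hull_minimal) (auto simp: quadratic_form_outer_product)
  then show "v \<bullet> (B *v v) \<ge> 0" using assms by auto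
qed

lemma inner_outer_product:
  fixes D :: "real^'n^'n"
  shows "D \<bullet> outer_product v v = v \<bullet> (D *v v)"
  by (simp add: inner_vec_def outer_product_def matrix_vector_mult_def sum_distrib_left mult_ac)

lemma norm_outer_product:
  fixes v :: "real^'n"
  shows "norm (outer_product v v) = (norm v)\<^sup>2"
proof -
  have "(norm (outer_product v v))\<^sup>2 = ((norm v)\<^sup>2)\<^sup>2"
    by (simp add: power2_norm_eq_inner inner_outer_product quadratic_form_outer_product)
  then show ?thesis by (rule power2_eq_imp_eq) auto
qed

lemma quadratic_form_diff_le:
  fixes A B :: "real^'n^'n"
  assumes "norm v = 1"
  shows "v \<bullet> (A *v v) \<le> v \<bullet> (B *v v) + dist A B"
proof -
  have "v \<bullet> (A *v v) - v \<bullet> (B *v v) = (A - B) \<bullet> outer_product v v"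
    by (simp add: inner_outer_product matrix_vector_mult_diff_rdistrib inner_diff_right)
  also have "\<dots> \<le> norm (A - B) * norm (outer_product v v)" by (rule norm_cauchy_schwarz)
  finally show ?thesis using assms by (simp add: norm_outer_product dist_norm)
qed

section \<open>Uniform continuity and compactness\<close>

lemma uniformly_close_parameters:
  fixes h :: "'a::metric_space \<Rightarrow> 'b::metric_space \<Rightarrow> 'c::metric_space"
  assumes "compact X" "compact \<Theta>" "continuous_on (X \<times> \<Theta>) (\<lambda>(y, \<tau>). h y \<tau>)"
    and "\<forall>\<^sub>F n in sequentially. \<tau> n \<in> \<Theta>" "\<tau> \<longlonglongrightarrow> l" "l \<in> \<Theta>" "e > 0"
  shows "\<forall>\<^sub>F n in sequentially. \<forall>y\<in>X. dist (h y (\<tau> n)) (h y l) < e"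
proof -
  have "uniformly_continuous_on (X \<times> \<Theta>) (\<lambda>(y, \<tau>). h y \<tau>)"
    using assms by (intro compact_uniformly_continuous compact_Times)
  then obtain d where d: "d > 0" "\<And>z z'. z \<in> X \<times> \<Theta> \<Longrightarrow> z' \<in> X \<times> \<Theta> \<Longrightarrow> dist z' z < d \<Longrightarrow>
      dist ((\<lambda>(y, \<tau>). h y \<tau>) z') ((\<lambda>(y, \<tau>). h y \<tau>) z) < e"
    unfolding uniformly_continuous_on_def using \<open>e > 0\<close> by metis
  have "\<forall>\<^sub>F n in sequentially. dist (\<tau> n) l < d" using assms(5) d(1) by (rule tendstoD)
  then show ?thesis using assms(4)
  proof eventually_elim
    case (elim n)
    show ?case
    proof
      fix y assume "y \<in> X"
      then show "dist (h y (\<tau> n)) (h y l) < e"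
        using d(2)[of "(y, l)" "(y, \<tau> n)"] elim \<open>l \<in> \<Theta>\<close> by (simp add: dist_Pair_Pair)
    qed
  qed
qed

lemma det_uniformly_continuous:
  assumes "e > 0"
  obtains d where "d > 0" "\<And>A A' :: real^'n^'n. norm A \<le> C \<Longrightarrow> norm A' \<le> C \<Longrightarrow> dist A A' < d \<Longrightarrow>
    \<bar>det A - det A'\<bar> < e"
proof -
  have "uniformly_continuous_on (cball (0 :: real^'n^'n) C) det"
    by (intro compact_uniformly_continuous continuous_intros) auto
  then show thesis
    using that assms unfolding uniformly_continuous_on_def by (force simp: dist_real_def)
qed

text \<open>By the matrix determinant lemma the sensitivity is a quotient of determinants, which is continuous on
  the compact set where the norms are bounded and the determinant is at least \<open>\<kappa>\<close>.\<close>

lemma sensitivity_uniformly_continuous: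
  assumes "e > 0" "\<kappa> > 0"
  obtains d where "d > 0"
    "\<And>A A' v v'. \<lbrakk>pos_def_matrix (A :: real^'n^'n); pos_def_matrix A'; norm A \<le> C; norm A' \<le> C;
      \<kappa> \<le> det A; \<kappa> \<le> det A'; norm v \<le> B; norm v' \<le> B; dist A A' < d; dist v v' < d\<rbrakk>
      \<Longrightarrow> \<bar>v \<bullet> (matrix_inv A *v v) - v' \<bullet> (matrix_inv A' *v v')\<bar> < e"
proof -
  define K where "K = {A :: real^'n^'n. norm A \<le> C \<and> \<kappa> \<le> det A} \<times> cball (0 :: real^'n) B"
  have "closed {A :: real^'n^'n. \<kappa> \<le> det A}"
    by (intro closed_Collect_le continuous_intros)
  then have "compact (cball 0 C \<inter> {A :: real^'n^'n. \<kappa> \<le> det A})"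
    by (intro compact_Int_closed) auto
  moreover have "{A :: real^'n^'n. norm A \<le> C \<and> \<kappa> \<le> det A} = cball 0 C \<inter> {A. \<kappa> \<le> det A}" by auto
  ultimately have "compact K" unfolding K_def by (intro compact_Times) auto
  define \<psi> where "\<psi> z = det (fst z + outer_product (snd z) (snd z)) / det (fst z) - 1"
    for z :: "(real^'n^'n) \<times> (real^'n)"
  have "continuous_on K \<psi>"
    unfolding \<psi>_def outer_product_def using \<open>\<kappa> > 0\<close>
    by (intro continuous_intros) (auto simp: K_def)
  with \<open>compact K\<close> have "uniformly_continuous_on K \<psi>" by (intro compact_uniformly_continuous)
  then obtain d where d: "d > 0" "\<And>z z'. z \<in> K \<Longrightarrow> z' \<in> K \<Longrightarrow> dist z' z < d \<Longrightarrow> dist (\<psi> z') (\<psi> z) < e"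
    unfolding uniformly_continuous_on_def using \<open>e > 0\<close> by metis
  have \<psi>: "\<psi> (A, v) = v \<bullet> (matrix_inv A *v v)" if "pos_def_matrix A" for A v
    using pos_def_det_pos[OF that]
    by (simp add: \<psi>_def matrix_determinant_lemma[OF pos_def_invertible[OF that]])
  show thesis
  proof
    \<comment> \<open>the distance in the product is at most the sum of the two distances\<close>
    show "d / 2 > 0" using d(1) by simp
    fix A A' :: "real^'n^'n" and v v' :: "real^'n"
    assume as: "pos_def_matrix A" "pos_def_matrix A'" "norm A \<le> C" "norm A' \<le> C"
      "\<kappa> \<le> det A" "\<kappa> \<le> det A'" "norm v \<le> B" "norm v' \<le> B" "dist A A' < d / 2" "dist v v' < d / 2"
    have "dist (A, v) (A', v') \<le> dist A A' + dist v v'"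
      unfolding dist_Pair_Pair by (intro sqrt_sum_squares_le_sum) auto
    then have "dist (\<psi> (A, v)) (\<psi> (A', v')) < e"
      using as by (intro d(2)) (auto simp: K_def)
    then show "\<bar>v \<bullet> (matrix_inv A *v v) - v' \<bullet> (matrix_inv A' *v v')\<bar> < e"
      using as by (simp add: \<psi> dist_real_def)
  qed
qed

lemma tendsto_unique_maximizer:
  fixes a :: "nat \<Rightarrow> 'c::metric_space" and \<phi> :: "'c \<Rightarrow> real"
  assumes "compact K" "continuous_on K \<phi>" "m \<in> K"
    and unique: "\<And>z. z \<in> K \<Longrightarrow> z \<noteq> m \<Longrightarrow> \<phi> z < \<phi> m"
    and inK: "\<forall>\<^sub>F n in sequentially. a n \<in> K"
    and sup: "\<And>c. c < \<phi> m \<Longrightarrow> \<forall>\<^sub>F n in sequentially. c < \<phi> (a n)"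
  shows "a \<longlonglongrightarrow> m"
proof (rule tendstoI)
  fix e :: real assume "e > 0"
  define L where "L = K - ball m e"
  have L: "compact L" "continuous_on L \<phi>"
    using assms(1,2) by (auto simp: L_def compact_diff intro: continuous_on_subset)
  show "\<forall>\<^sub>F n in sequentially. dist (a n) m < e"
  proof (cases "L = {}")
    case True
    show ?thesis using inK by eventually_elim (use True in \<open>auto simp: L_def dist_commute\<close>)
  next
    case False
    then obtain z where z: "z \<in> L" "\<And>w. w \<in> L \<Longrightarrow> \<phi> w \<le> \<phi> z"
      using continuous_attains_sup[OF L(1) _ L(2)] by blast
    have "\<phi> z < \<phi> m" using z(1) \<open>e > 0\<close> by (intro unique) (auto simp: L_def)
    from sup[OF this] inK show ?thesis
    proof eventually_elim
      case (elim n)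
      then have "a n \<notin> L" using z(2)[of "a n"] by fastforce
      then show ?case using elim by (auto simp: L_def dist_commute)
    qed
  qed
qed

text \<open>Strict concavity of \<open>log det\<close>: the strict tangent inequality at the midpoint \<open>H\<close>, for both end
  points, contradicts that \<open>trace (H\<^sup>-\<^sup>1 M)\<close> averages to the dimension over the two.\<close>

lemma det_maximizer_unique:
  fixes M\<^sub>1 M\<^sub>2 :: "real^'n^'n"
  assumes M\<^sub>1: "pos_def_matrix M\<^sub>1" and M\<^sub>2: "pos_def_matrix M\<^sub>2"
    and "det ((1/2) *\<^sub>R M\<^sub>1 + (1/2) *\<^sub>R M\<^sub>2) \<le> d" "det M\<^sub>1 = d" "det M\<^sub>2 = d"
  shows "M\<^sub>1 = M\<^sub>2"
proof (rule ccontr)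
  assume ne: "M\<^sub>1 \<noteq> M\<^sub>2"
  define H where "H = (1/2) *\<^sub>R M\<^sub>1 + (1/2) *\<^sub>R M\<^sub>2"
  have H: "pos_def_matrix H" unfolding H_def
    using M\<^sub>1 M\<^sub>2 by (intro pos_def_matrix_add pos_def_matrix_scaleR)
      (auto simp: transpose_scaleR pos_def_matrix_sym quadratic_form_scaleR pos_def_matrix_nonneg)
  define L where "L B = trace (matrix_inv H ** B)" for B
  have "L H = real CARD('n)"
    by (simp add: L_def matrix_inv_inverse(2)[OF pos_def_invertible[OF H]] trace_I)
  moreover have "L H = (1/2) * L M\<^sub>1 + (1/2) * L M\<^sub>2"
  proof -
    have "linear L" unfolding L_def[abs_def] by (rule linear_trace_mult)
    then show ?thesis by (subst H_def) (simp add: linear_add linear_cmul)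
  qed
  ultimately have sum: "L M\<^sub>1 + L M\<^sub>2 = 2 * real CARD('n)" by linarith
  have d: "d > 0" using pos_def_det_pos[OF M\<^sub>1] assms(4) by simp
  have neH: "M\<^sub>1 \<noteq> H" "M\<^sub>2 \<noteq> H"
  proof -
    have "M\<^sub>1 - H = (1/2) *\<^sub>R (M\<^sub>1 - M\<^sub>2)" "M\<^sub>2 - H = (1/2) *\<^sub>R (M\<^sub>2 - M\<^sub>1)"
      by (simp_all add: H_def algebra_simps flip: scaleR_left_distrib)
    then show "M\<^sub>1 \<noteq> H" "M\<^sub>2 \<noteq> H" using ne by auto
  qed
  have "L M > real CARD('n)" if "pos_def_matrix M" "M \<noteq> H" "det M = d" for M
  proof -
    have "d < det H * exp (L M - real CARD('n))"
      using det_le_exp_trace(2)[OF H pos_def_matrix_sym[OF that(1)] pos_def_matrix_nonneg[OF that(1)] that(2)]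
        that(3) by (simp add: L_def)
    also have "\<dots> \<le> d * exp (L M - real CARD('n))"
      using assms(3) by (simp add: H_def)
    finally show ?thesis using d by simp
  qed
  from this[OF M\<^sub>1 neH(1) assms(4)] this[OF M\<^sub>2 neH(2) assms(5)] sum show False by linarith
qed

section \<open>Convergence of the algorithm\<close>

locale convergent_wynn =
  fixes X :: "'a::metric_space set" and \<Theta> :: "'b::metric_space set"
    and f :: "'b \<Rightarrow> 'a \<Rightarrow> real^'p" and nst :: nat
    and \<theta> :: "nat \<Rightarrow> 'b" and \<theta>bar :: 'b and x :: "nat \<Rightarrow> 'a"
  assumes compact_X: "compact X" and compact_\<Theta>: "compact \<Theta>"
    and continuous_f: "continuous_on (X \<times> \<Theta>) (\<lambda>(y, \<tau>). f \<tau> y)"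
    and \<theta>_in: "\<And>n. n \<ge> nst \<Longrightarrow> \<theta> n \<in> \<Theta>"
    and wynn: "wynn_sequence f X \<Theta> nst \<theta> x"
    and \<theta>bar_in: "\<theta>bar \<in> \<Theta>" and \<theta>_lim: "\<theta> \<longlonglongrightarrow> \<theta>bar"
begin

abbreviation M :: "'b \<Rightarrow> nat \<Rightarrow> real^'p^'p" where
  "M \<tau> n \<equiv> info_matrix f (empirical_design x n) \<tau>"

abbreviation op :: "'b \<Rightarrow> 'a \<Rightarrow> real^'p^'p" where
  "op \<tau> y \<equiv> outer_product (f \<tau> y) (f \<tau> y)"

lemma nst_ge_1: "nst \<ge> 1"
  using wynn by (simp add: wynn_sequence_def)

lemma x_in: "i \<ge> 1 \<Longrightarrow> x i \<in> X"
proof (cases "i \<le> nst")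
  case False
  then obtain k where "i = Suc k" "k \<ge> nst" by (cases i) auto
  then show ?thesis using wynn by (simp add: wynn_sequence_def)
qed (use wynn in \<open>auto simp: wynn_sequence_def\<close>)

lemma x_Suc_maximizes:
  assumes "n \<ge> nst" "y \<in> X"
  shows "f (\<theta> n) y \<bullet> (matrix_inv (M (\<theta> n) n) *v f (\<theta> n) y)
    \<le> f (\<theta> n) (x (Suc n)) \<bullet> (matrix_inv (M (\<theta> n) n) *v f (\<theta> n) (x (Suc n)))"
  using wynn assms by (simp add: wynn_sequence_def sensitivity_def)

lemma M_pos_def:
  assumes "n \<ge> nst" "\<tau> \<in> \<Theta>"
  shows "pos_def_matrix (M \<tau> n)"
  using assms(1)
proof (induction n rule: dec_induct)
  case base
  then show ?case using wynn assms(2) by (simp add: wynn_sequence_def)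
next
  case (step n)
  then have n: "n \<ge> 1" using nst_ge_1 by linarith
  show ?case
    using det_recursion_step_ge(1)[OF step.IH n order_refl, of _ "f \<tau> (x (Suc n))"]
    by (simp add: empirical_info_matrix_Suc[OF n])
qed

lemma M_in_hull:
  assumes "n \<ge> nst"
  shows "M \<tau> n \<in> convex hull (op \<tau> ` X)"
  using assms nst_ge_1 x_in by (intro info_matrix_in_convex_hull empirical_design_is_design) auto

lemma continuous_op: "continuous_on (X \<times> \<Theta>) (\<lambda>(y, \<tau>). op \<tau> y)"
  using continuous_f unfolding outer_product_def case_prod_beta by (intro continuous_intros) auto

lemma f_bounded:
  obtains B where "B > 0" "\<And>\<tau> y. \<tau> \<in> \<Theta> \<Longrightarrow> y \<in> X \<Longrightarrow> norm (f \<tau> y) \<le> B"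
proof -
  have "bounded ((\<lambda>(y, \<tau>). f \<tau> y) ` (X \<times> \<Theta>))"
    by (intro compact_imp_bounded compact_continuous_image continuous_f compact_Times compact_X compact_\<Theta>)
  then obtain B where "B > 0" "\<forall>z\<in>(\<lambda>(y, \<tau>). f \<tau> y) ` (X \<times> \<Theta>). norm z \<le> B"
    unfolding bounded_pos by blast
  then show thesis using that by fastforce
qed

lemma hull_bounded:
  obtains C where "C > 0" "\<And>\<tau> A. \<tau> \<in> \<Theta> \<Longrightarrow> A \<in> convex hull (op \<tau> ` X) \<Longrightarrow> norm A \<le> C"
proof -
  obtain B where B: "B > 0" "\<And>\<tau> y. \<tau> \<in> \<Theta> \<Longrightarrow> y \<in> X \<Longrightarrow> norm (f \<tau> y) \<le> B"
    using f_bounded by blast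
  have "convex hull (op \<tau> ` X) \<subseteq> cball 0 (B\<^sup>2)" if "\<tau> \<in> \<Theta>" for \<tau>
    using B that by (intro hull_minimal) (auto simp: norm_outer_product intro!: power_mono)
  then show thesis using that[of "B\<^sup>2"] B(1) by force
qed

lemma compact_hull:
  assumes "\<tau> \<in> \<Theta>"
  shows "compact (convex hull (op \<tau> ` X))"
proof -
  have "continuous_on X (\<lambda>y. op \<tau> y)"
    using continuous_on_compose2[OF continuous_op, of X "\<lambda>y. (y, \<tau>)"] assms
    by (force intro: continuous_intros)
  then show ?thesis by (intro compact_convex_hull compact_continuous_image compact_X)
qed

lemma det_hull_bounded:
  assumes "\<tau> \<in> \<Theta>"
  obtains D where "\<forall>A\<in>convex hull (op \<tau> ` X). det (A + \<delta> *\<^sub>R mat 1) \<le> D"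
proof -
  have "compact ((\<lambda>A. det (A + \<delta> *\<^sub>R mat 1)) ` (convex hull (op \<tau> ` X)))"
    by (intro compact_continuous_image continuous_intros compact_hull assms)
  then have "bdd_above ((\<lambda>A. det (A + \<delta> *\<^sub>R mat 1)) ` (convex hull (op \<tau> ` X)))"
    by (intro bounded_imp_bdd_above compact_imp_bounded)
  then show thesis using that by (auto simp: bdd_above_def)
qed

lemma M_close:
  assumes "\<forall>\<^sub>F n in sequentially. \<tau> n \<in> \<Theta>" "\<tau> \<longlonglongrightarrow> \<theta>bar" "e > 0"
  shows "\<forall>\<^sub>F n in sequentially. dist (M (\<tau> n) n) (M \<theta>bar n) < e"
proof -
  have "\<forall>\<^sub>F n in sequentially. \<forall>y\<in>X. dist (op (\<tau> n) y) (op \<theta>bar y) < e"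
    by (rule uniformly_close_parameters[OF compact_X compact_\<Theta> continuous_op assms(1,2) \<theta>bar_in assms(3)])
  then show ?thesis using eventually_ge_at_top[of 1]
  proof eventually_elim
    case (elim n)
    have "M (\<tau> n) n - M \<theta>bar n = (1 / real n) *\<^sub>R (\<Sum>i=1..n. op (\<tau> n) (x i) - op \<theta>bar (x i))"
      using elim(2) by (simp add: info_matrix_empirical_design sum_subtractf scaleR_diff_right)
    then have "dist (M (\<tau> n) n) (M \<theta>bar n)
        = (1 / real n) * norm (\<Sum>i=1..n. op (\<tau> n) (x i) - op \<theta>bar (x i))"
      by (simp add: dist_norm)
    moreover have "norm (\<Sum>i=1..n. op (\<tau> n) (x i) - op \<theta>bar (x i))
        \<le> (\<Sum>i=1..n. dist (op (\<tau> n) (x i)) (op \<theta>bar (x i)))"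
      unfolding dist_norm by (rule norm_sum)
    moreover have "(\<Sum>i=1..n. dist (op (\<tau> n) (x i)) (op \<theta>bar (x i))) < (\<Sum>i=1..n. e)"
      using elim x_in by (intro sum_strict_mono) auto
    then have "(\<Sum>i=1..n. dist (op (\<tau> n) (x i)) (op \<theta>bar (x i))) < real n * e" by simp
    ultimately show ?case using elim(2) by (simp add: divide_less_eq mult_ac)
  qed
qed

lemma f_close:
  assumes "e > 0"
  shows "\<forall>\<^sub>F n in sequentially. \<forall>y\<in>X. dist (f (\<theta> n) y) (f \<theta>bar y) < e"
  by (rule uniformly_close_parameters[OF compact_X compact_\<Theta> continuous_f _ \<theta>_lim \<theta>bar_in assms])
    (auto simp: eventually_sequentially intro: \<theta>_in)

lemma eventually_\<theta>_in: "\<forall>\<^sub>F n in sequentially. \<theta> n \<in> \<Theta>"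
  using \<theta>_in by (auto simp: eventually_sequentially)

text \<open>The starting design is nonsingular at the limit parameter, so its quadratic form is bounded below
  on the unit sphere; this form is an average of squares \<open>(v \<bullet> f \<theta>bar y)\<^sup>2\<close>. The factor 3 leaves room
  for replacing the parameter twice.\<close>

lemma uniformly_detected_directions:
  obtains b where "b > 0" "\<And>v. norm v = 1 \<Longrightarrow> \<exists>y\<in>X. 3 * b \<le> \<bar>v \<bullet> f \<theta>bar y\<bar>"
proof -
  obtain v\<^sub>0 where v\<^sub>0: "norm v\<^sub>0 = 1"
    "\<And>w. norm w = 1 \<Longrightarrow> v\<^sub>0 \<bullet> (M \<theta>bar nst *v v\<^sub>0) \<le> w \<bullet> (M \<theta>bar nst *v w)"
    using exists_min_quadratic_form[of "M \<theta>bar nst"] by blast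
  define c where "c = v\<^sub>0 \<bullet> (M \<theta>bar nst *v v\<^sub>0)"
  have "v\<^sub>0 \<noteq> 0" using v\<^sub>0(1) by auto
  then have c: "c > 0" unfolding c_def
    by (rule pos_def_matrix_pos[OF M_pos_def[OF order_refl \<theta>bar_in]])
  have "\<exists>y\<in>X. 3 * (sqrt c / 3) \<le> \<bar>v \<bullet> f \<theta>bar y\<bar>" if "norm v = 1" for v
  proof -
    obtain y where y: "y \<in> X" "v \<bullet> (M \<theta>bar nst *v v) \<le> v \<bullet> (op \<theta>bar y *v v)"
      using linear_le_on_convex_hull_image[OF linear_quadratic_form M_in_hull[OF order_refl]] by blast
    then have "c \<le> (v \<bullet> f \<theta>bar y)\<^sup>2"
      using v\<^sub>0(2)[OF that] by (simp add: c_def quadratic_form_outer_product inner_commute)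
    then show ?thesis using y(1) real_sqrt_le_mono by fastforce
  qed
  then show thesis using that[of "sqrt c / 3"] c by auto
qed

text \<open>For regularization \<open>\<delta> \<le> \<mu>\<close>, the determinant of \<open>M \<theta>bar n + \<delta> I\<close> has an upward drift as soon as it is
  below a threshold \<open>\<kappa>\<^sub>0\<close> that depends on \<open>\<mu>\<close> only. So it eventually exceeds \<open>\<kappa>\<^sub>0 / 2\<close> for every such \<open>\<delta>\<close>,
  and letting \<open>\<delta>\<close> be small transfers the bound to \<open>M \<theta>bar n\<close>. The regularization is needed because the
  deviation between the matrices at \<open>\<theta> n\<close> and at \<open>\<theta>bar\<close> is eventually smaller than any fixed \<open>\<delta>\<close>, but
  cannot be compared in advance with the smallest eigenvalue of \<open>M \<theta>bar n\<close>.\<close>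

lemma det_M_bounded_below:
  obtains \<kappa> where "\<kappa> > 0" "\<forall>\<^sub>F n in sequentially. \<kappa> \<le> det (M \<theta>bar n)"
proof -
  define p where "p = real CARD('p)"
  obtain b where b: "b > 0" "\<And>v. norm v = 1 \<Longrightarrow> \<exists>y\<in>X. 3 * b \<le> \<bar>v \<bullet> f \<theta>bar y\<bar>"
    using uniformly_detected_directions by blast
  obtain B where B: "B > 0" "\<And>\<tau> y. \<tau> \<in> \<Theta> \<Longrightarrow> y \<in> X \<Longrightarrow> norm (f \<tau> y) \<le> B"
    using f_bounded by blast
  obtain C where C: "C > 0" "\<And>\<tau> A. \<tau> \<in> \<Theta> \<Longrightarrow> A \<in> convex hull (op \<tau> ` X) \<Longrightarrow> norm A \<le> C"
    using hull_bounded by blast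
  define Q where "Q = B\<^sup>2 / (2 * b\<^sup>2) + 2"
  have Q: "Q > 0" by (simp add: Q_def add_nonneg_pos)
  have p: "p \<ge> 0" by (simp add: p_def)
  \<comment> \<open>chosen so that the bound of \<open>sensitivity_large_if_nearly_singular\<close> equals \<open>p + 2\<close>, that is, drift at rate 1\<close>
  define \<mu> where "\<mu> = b\<^sup>2 / ((p + 2) * Q)"
  have \<mu>: "\<mu> > 0" "b\<^sup>2 / (\<mu> * Q) = p + 2"
    using b(1) Q p by (simp_all add: \<mu>_def)
  define \<kappa>\<^sub>0 where "\<kappa>\<^sub>0 = \<mu> ^ CARD('p) / 2"
  have \<kappa>\<^sub>0: "\<kappa>\<^sub>0 > 0" "\<kappa>\<^sub>0 < \<mu> ^ CARD('p)" using \<mu>(1) by (simp_all add: \<kappa>\<^sub>0_def)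
  have reg_pd: "pos_def_matrix (M \<theta>bar n + \<delta> *\<^sub>R mat 1)" if "n \<ge> nst" "\<delta> \<ge> 0" for n \<delta>
    using M_pos_def[OF that(1) \<theta>bar_in] that(2)
    by (intro pos_def_matrix_add) (auto simp: transpose_scaleR transpose_mat quadratic_form_scaleR)
  have reg: "\<forall>\<^sub>F n in sequentially. \<kappa>\<^sub>0 / 2 \<le> det (M \<theta>bar n + \<delta> *\<^sub>R mat 1)"
    if \<delta>: "0 \<le> \<delta>" "\<delta> \<le> \<mu>" for \<delta>
  proof -
    obtain D where D: "\<forall>A\<in>convex hull (op \<theta>bar ` X). det (A + \<delta> *\<^sub>R mat 1) \<le> D"
      using det_hull_bounded[OF \<theta>bar_in, where \<delta> = \<delta>] .
    have drift: "\<forall>\<^sub>F n in sequentially. det (M \<theta>bar n + \<delta> *\<^sub>R mat 1) \<le> \<kappa>\<^sub>0 \<longrightarrow>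
      real CARD('p) + 2 * 1 \<le> f \<theta>bar (x (Suc n)) \<bullet>
        (matrix_inv (M \<theta>bar n + \<delta> *\<^sub>R mat 1) *v f \<theta>bar (x (Suc n)))"
      using M_close[OF eventually_\<theta>_in \<theta>_lim \<mu>(1)] f_close[OF b(1)] eventually_ge_at_top[of nst]
    proof eventually_elim
      case (elim n)
      note n = elim(3)
      define A where "A = M (\<theta> n) n"
      define N where "N = M \<theta>bar n + \<delta> *\<^sub>R mat 1"
      have A: "pos_def_matrix A" unfolding A_def using M_pos_def[OF n \<theta>_in[OF n]] .
      have N: "pos_def_matrix N" unfolding N_def using reg_pd[OF n \<delta>(1)] .
      have xX: "x (Suc n) \<in> X" by (rule x_in) simp
      have quadN: "w \<bullet> (N *v w) = w \<bullet> (M \<theta>bar n *v w) + \<delta>" if "norm w = 1" for w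
        using that by (simp add: N_def matrix_vector_mult_add_rdistrib inner_add_right quadratic_form_mat_1)
      have dirs: "\<exists>h. 2 * b \<le> \<bar>v \<bullet> h\<bar> \<and>
          h \<bullet> (matrix_inv A *v h) \<le> f (\<theta> n) (x (Suc n)) \<bullet> (matrix_inv A *v f (\<theta> n) (x (Suc n)))"
        if v: "norm v = 1" for v
      proof -
        obtain y where y: "y \<in> X" "3 * b \<le> \<bar>v \<bullet> f \<theta>bar y\<bar>" using b(2)[OF v] by blast
        have "\<bar>v \<bullet> (f (\<theta> n) y - f \<theta>bar y)\<bar> \<le> b"
          using Cauchy_Schwarz_ineq2[of v "f (\<theta> n) y - f \<theta>bar y"] v elim(2) y(1)
          by (fastforce simp: dist_norm)
        then have "2 * b \<le> \<bar>v \<bullet> f (\<theta> n) y\<bar>" using y(2) by (simp add: inner_diff_right)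
        then show ?thesis using x_Suc_maximizes[OF n y(1)] unfolding A_def by blast
      qed
      show ?case
      proof
        assume "det (M \<theta>bar n + \<delta> *\<^sub>R mat 1) \<le> \<kappa>\<^sub>0"
        then have "det N < \<mu> ^ CARD('p)" using \<kappa>\<^sub>0 by (simp add: N_def)
        then obtain v\<^sub>0 where v\<^sub>0: "norm v\<^sub>0 = 1" "v\<^sub>0 \<bullet> (N *v v\<^sub>0) \<le> \<mu>"
          using exists_unit_vector_small_quadratic_form[OF N \<mu>(1)] by blast
        have "b\<^sup>2 / (\<mu> * (B\<^sup>2 / (2 * b\<^sup>2) + 2))
          \<le> f \<theta>bar (x (Suc n)) \<bullet> (matrix_inv N *v f \<theta>bar (x (Suc n)))"
        proof (rule sensitivity_large_if_nearly_singular[OF A N _ _ v\<^sub>0 \<mu>(1) b(1) _ _ dirs])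
          fix w :: "real^'p" assume w: "norm w = 1"
          show "w \<bullet> (A *v w) \<le> w \<bullet> (N *v w) + \<mu>"
            using quadratic_form_diff_le[OF w, of A "M \<theta>bar n"] elim(1) \<delta> quadN[OF w]
            by (simp add: A_def)
          show "w \<bullet> (N *v w) \<le> w \<bullet> (A *v w) + 2 * \<mu>"
            using quadratic_form_diff_le[OF w, of "M \<theta>bar n" A] elim(1) \<delta> quadN[OF w]
            by (simp add: A_def dist_commute)
        next
          show "norm (f (\<theta> n) (x (Suc n))) \<le> B" using B(2)[OF \<theta>_in[OF n] xX] .
          show "norm (f (\<theta> n) (x (Suc n)) - f \<theta>bar (x (Suc n))) \<le> b"
            using elim(2) xX by (fastforce simp: dist_norm)
        qed auto
        then show "real CARD('p) + 2 * 1 \<le> f \<theta>bar (x (Suc n)) \<bullet>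
            (matrix_inv (M \<theta>bar n + \<delta> *\<^sub>R mat 1) *v f \<theta>bar (x (Suc n)))"
          using \<mu>(2) by (simp add: Q_def[symmetric] p_def N_def)
      qed
    qed
    show ?thesis
    proof (rule eventually_det_ge[where m = nst and g = "\<lambda>n. f \<theta>bar (x (Suc n))" and r = 1
          and \<kappa> = \<kappa>\<^sub>0 and B = D, OF _ _ \<delta>(1) _ drift])
      fix n assume n: "n \<ge> nst"
      show "M \<theta>bar (Suc n) = (real n / real (Suc n)) *\<^sub>R M \<theta>bar n + (1 / real (Suc n)) *\<^sub>R op \<theta>bar (x (Suc n))"
        using n nst_ge_1 by (intro empirical_info_matrix_Suc) simp
      show "pos_def_matrix (M \<theta>bar n + \<delta> *\<^sub>R mat 1)" by (rule reg_pd[OF n \<delta>(1)])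
      show "det (M \<theta>bar n + \<delta> *\<^sub>R mat 1) \<le> D" using D M_in_hull[OF n] by blast
    qed (use \<kappa>\<^sub>0 in auto)
  qed
  define I where "I = norm (mat 1 :: real^'p^'p)"
  obtain d where d: "d > 0" "\<And>A A' :: real^'p^'p. norm A \<le> C + \<mu> * I \<Longrightarrow> norm A' \<le> C + \<mu> * I \<Longrightarrow>
      dist A A' < d \<Longrightarrow> \<bar>det A - det A'\<bar> < \<kappa>\<^sub>0 / 4"
    using det_uniformly_continuous[of "\<kappa>\<^sub>0 / 4" "C + \<mu> * I"] \<kappa>\<^sub>0(1) by auto
  \<comment> \<open>small enough that adding \<open>\<delta> I\<close> changes the determinant by less than \<open>\<kappa>\<^sub>0 / 4\<close>\<close>
  define \<delta> where "\<delta> = min \<mu> (d / (2 * (I + 1)))"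
  have I: "I \<ge> 0" by (simp add: I_def)
  have \<delta>: "0 < \<delta>" "\<delta> \<le> \<mu>" using \<mu>(1) d(1) I by (auto simp: \<delta>_def)
  have "\<delta> * I < d"
  proof -
    have "\<delta> * I \<le> d / (2 * (I + 1)) * I" using I by (intro mult_right_mono) (auto simp: \<delta>_def)
    also have "\<dots> < d" using d(1) mult_nonneg_nonneg[OF I less_imp_le[OF d(1)]] I
      by (simp add: divide_less_eq algebra_simps add_nonneg_pos)
    finally show ?thesis .
  qed
  have "\<forall>\<^sub>F n in sequentially. \<kappa>\<^sub>0 / 4 \<le> det (M \<theta>bar n)"
    using reg[OF less_imp_le[OF \<delta>(1)] \<delta>(2)] eventually_ge_at_top[of nst]
  proof eventually_elim
    case (elim n)
    have nM: "norm (M \<theta>bar n) \<le> C" by (rule C(2)[OF \<theta>bar_in M_in_hull[OF elim(2)]])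
    have "\<delta> * I \<le> \<mu> * I" using \<delta> I by (intro mult_right_mono) auto
    moreover have "norm (M \<theta>bar n + \<delta> *\<^sub>R mat 1) \<le> norm (M \<theta>bar n) + \<delta> * I"
      using norm_triangle_ineq[of "M \<theta>bar n" "\<delta> *\<^sub>R mat 1"] \<delta>(1) by (simp add: I_def)
    moreover have "dist (M \<theta>bar n + \<delta> *\<^sub>R mat 1) (M \<theta>bar n) = \<delta> * I"
      using \<delta>(1) by (simp add: dist_norm I_def)
    moreover have "\<mu> * I \<ge> 0" using \<mu>(1) I by simp
    ultimately have "\<bar>det (M \<theta>bar n + \<delta> *\<^sub>R mat 1) - det (M \<theta>bar n)\<bar> < \<kappa>\<^sub>0 / 4"
      using nM \<open>\<delta> * I < d\<close> by (intro d(2)) auto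
    then show ?case using elim(1) by linarith
  qed
  then show thesis using that[of "\<kappa>\<^sub>0 / 4"] \<kappa>\<^sub>0(1) by simp
qed

text \<open>By the tangent inequality, a log-determinant that is \<open>4 r\<close> below that of \<open>S\<close> forces the average of the
  sensitivity with respect to \<open>S\<close>, and so its value at some point \<open>y\<close>, to be at least \<open>p + 4 r\<close>. Since
  the determinants are bounded below, sensitivities at \<open>\<theta> n\<close> and at \<open>\<theta>bar\<close> eventually differ by less than
  \<open>r\<close>; passing from \<open>y\<close> at \<open>\<theta>bar\<close> to \<open>\<theta> n\<close>, to the chosen maximizer there, and back to \<open>\<theta>bar\<close> costs
  \<open>2 r\<close>, and the remaining \<open>2 r\<close> is the drift.\<close>

lemma det_M_eventually_near_optimal:
  assumes S: "S \<in> convex hull (op \<theta>bar ` X)" and "r > 0" "det S > 0"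
  shows "\<forall>\<^sub>F n in sequentially. det S * exp (- 5 * r) \<le> det (M \<theta>bar n)"
proof -
  obtain B where B: "B > 0" "\<And>\<tau> y. \<tau> \<in> \<Theta> \<Longrightarrow> y \<in> X \<Longrightarrow> norm (f \<tau> y) \<le> B"
    using f_bounded by blast
  obtain C where C: "C > 0" "\<And>\<tau> A. \<tau> \<in> \<Theta> \<Longrightarrow> A \<in> convex hull (op \<tau> ` X) \<Longrightarrow> norm A \<le> C"
    using hull_bounded by blast
  obtain \<kappa> where \<kappa>: "\<kappa> > 0" "\<forall>\<^sub>F n in sequentially. \<kappa> \<le> det (M \<theta>bar n)"
    using det_M_bounded_below by blast
  obtain d\<^sub>1 where d\<^sub>1: "d\<^sub>1 > 0" "\<And>A A' :: real^'p^'p. norm A \<le> C \<Longrightarrow> norm A' \<le> C \<Longrightarrow>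
      dist A A' < d\<^sub>1 \<Longrightarrow> \<bar>det A - det A'\<bar> < \<kappa> / 2"
    using det_uniformly_continuous[of "\<kappa> / 2" C] \<kappa>(1) by auto
  obtain d\<^sub>2 where d\<^sub>2: "d\<^sub>2 > 0"
    "\<And>A A' v v'. \<lbrakk>pos_def_matrix (A :: real^'p^'p); pos_def_matrix A'; norm A \<le> C; norm A' \<le> C;
      \<kappa> / 2 \<le> det A; \<kappa> / 2 \<le> det A'; norm v \<le> B; norm v' \<le> B; dist A A' < d\<^sub>2; dist v v' < d\<^sub>2\<rbrakk>
      \<Longrightarrow> \<bar>v \<bullet> (matrix_inv A *v v) - v' \<bullet> (matrix_inv A' *v v')\<bar> < r"
    using sensitivity_uniformly_continuous[of r "\<kappa> / 2" C B] \<open>r > 0\<close> \<kappa>(1) by auto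
  have d: "min d\<^sub>1 d\<^sub>2 > 0" using d\<^sub>1 d\<^sub>2 by simp
  have drift: "\<forall>\<^sub>F n in sequentially. det (M \<theta>bar n + 0 *\<^sub>R mat 1) \<le> det S * exp (- 4 * r) \<longrightarrow>
      real CARD('p) + 2 * r \<le> f \<theta>bar (x (Suc n)) \<bullet>
        (matrix_inv (M \<theta>bar n + 0 *\<^sub>R mat 1) *v f \<theta>bar (x (Suc n)))"
    using M_close[OF eventually_\<theta>_in \<theta>_lim d] f_close[OF d\<^sub>2(1)] eventually_ge_at_top[of nst] \<kappa>(2)
  proof eventually_elim
    case (elim n)
    note n = elim(3)
    define A where "A = M (\<theta> n) n"
    define N where "N = M \<theta>bar n"
    have A: "pos_def_matrix A" unfolding A_def using M_pos_def[OF n \<theta>_in[OF n]] .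
    have N: "pos_def_matrix N" unfolding N_def using M_pos_def[OF n \<theta>bar_in] .
    have norms: "norm A \<le> C" "norm N \<le> C"
      unfolding A_def N_def using C(2) M_in_hull[OF n] \<theta>_in[OF n] \<theta>bar_in by blast+
    have dist: "dist A N < d\<^sub>1" "dist A N < d\<^sub>2" using elim(1) by (auto simp: A_def N_def)
    have dets: "\<kappa> / 2 \<le> det A" "\<kappa> / 2 \<le> det N"
      using d\<^sub>1(2)[OF norms dist(1)] elim(4) \<kappa>(1) unfolding N_def[symmetric] by linarith+
    have close: "\<bar>f (\<theta> n) y \<bullet> (matrix_inv A *v f (\<theta> n) y) - f \<theta>bar y \<bullet> (matrix_inv N *v f \<theta>bar y)\<bar> < r"
      if "y \<in> X" for y
      using B(2) \<theta>_in[OF n] \<theta>bar_in that elim(2) by (intro d\<^sub>2(2)[OF A N norms dets _ _ dist(2)]) auto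
    have xX: "x (Suc n) \<in> X" by (rule x_in) simp
    show ?case
    proof
      assume "det (M \<theta>bar n + 0 *\<^sub>R mat 1) \<le> det S * exp (- 4 * r)"
      then have le: "det N \<le> det S * exp (- 4 * r)" by (simp add: N_def)
      define t where "t = trace (matrix_inv N ** S)"
      have "det S \<le> det N * exp (t - real CARD('p))"
        unfolding t_def by (intro det_le_exp_trace(1) N convex_hull_outer_products_psd[OF S])
      also have "\<dots> \<le> det S * exp (- 4 * r) * exp (t - real CARD('p))"
        using le by (intro mult_right_mono) auto
      finally have "det S * 1 \<le> det S * (exp (- 4 * r) * exp (t - real CARD('p)))"
        by (simp only: mult.assoc mult_1_right)
      then have "1 \<le> exp (- 4 * r + (t - real CARD('p)))"
        using \<open>det S > 0\<close> by (simp only: mult_le_cancel_left_pos exp_add)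
      then have t: "real CARD('p) + 4 * r \<le> t" by simp
      obtain y where y: "y \<in> X" "t \<le> f \<theta>bar y \<bullet> (matrix_inv N *v f \<theta>bar y)"
        using linear_le_on_convex_hull_image[OF linear_trace_mult S, of "matrix_inv N"]
        unfolding trace_mult_outer_product t_def by blast
      have "f (\<theta> n) y \<bullet> (matrix_inv A *v f (\<theta> n) y)
          \<le> f (\<theta> n) (x (Suc n)) \<bullet> (matrix_inv A *v f (\<theta> n) (x (Suc n)))"
        unfolding A_def by (rule x_Suc_maximizes[OF n y(1)])
      then have "real CARD('p) + 2 * r \<le> f \<theta>bar (x (Suc n)) \<bullet> (matrix_inv N *v f \<theta>bar (x (Suc n)))"
        using t y(2) close[OF y(1)] close[OF xX] by linarith
      then show "real CARD('p) + 2 * r \<le> f \<theta>bar (x (Suc n)) \<bullet>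
          (matrix_inv (M \<theta>bar n + 0 *\<^sub>R mat 1) *v f \<theta>bar (x (Suc n)))"
        by (simp add: N_def)
    qed
  qed
  obtain D where D: "\<forall>A\<in>convex hull (op \<theta>bar ` X). det (A + 0 *\<^sub>R mat 1) \<le> D"
    using det_hull_bounded[OF \<theta>bar_in, where \<delta> = 0] .
  have "\<forall>\<^sub>F n in sequentially. det S * exp (- 5 * r) \<le> det (M \<theta>bar n + 0 *\<^sub>R mat 1)"
  proof (rule eventually_det_ge[where m = nst and g = "\<lambda>n. f \<theta>bar (x (Suc n))" and r = r
        and \<kappa> = "det S * exp (- 4 * r)" and B = D, OF _ _ order_refl _ drift \<open>r > 0\<close>])
    fix n assume n: "n \<ge> nst"
    show "M \<theta>bar (Suc n) = (real n / real (Suc n)) *\<^sub>R M \<theta>bar n + (1 / real (Suc n)) *\<^sub>R op \<theta>bar (x (Suc n))"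
      using n nst_ge_1 by (intro empirical_info_matrix_Suc) simp
    show "pos_def_matrix (M \<theta>bar n + 0 *\<^sub>R mat 1)" using M_pos_def[OF n \<theta>bar_in] by simp
    show "det (M \<theta>bar n + 0 *\<^sub>R mat 1) \<le> D" using D M_in_hull[OF n] by blast
  qed (use \<open>det S > 0\<close> \<open>r > 0\<close> in auto)
  then show ?thesis by simp
qed

lemma exists_locally_D_optimal: "\<exists>\<xi>. locally_D_optimal f X \<theta>bar \<xi>"
proof -
  have "convex hull (op \<theta>bar ` X) \<noteq> {}" using M_in_hull[OF order_refl, of \<theta>bar] by blast
  then obtain S where S: "S \<in> convex hull (op \<theta>bar ` X)"
    "\<And>A. A \<in> convex hull (op \<theta>bar ` X) \<Longrightarrow> det A \<le> det S"
    using continuous_attains_sup[OF compact_hull[OF \<theta>bar_in] _ continuous_on_det[OF continuous_on_id]]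
    by blast
  obtain \<xi> where "is_design X \<xi>" "info_matrix f \<xi> \<theta>bar = S"
    using convex_hull_imp_info_matrix[where f = f and \<tau> = \<theta>bar, OF S(1)] .
  then show ?thesis
    using S(2) info_matrix_in_convex_hull by (metis locally_D_optimal_def)
qed

lemma M_tendsto_optimal:
  assumes opt: "locally_D_optimal f X \<theta>bar \<xi>"
  shows "M \<theta>bar \<longlonglongrightarrow> info_matrix f \<xi> \<theta>bar"
proof -
  define S where "S = info_matrix f \<xi> \<theta>bar"
  define K where "K = convex hull (op \<theta>bar ` X)"
  have S: "S \<in> K"
    using opt unfolding S_def K_def locally_D_optimal_def by (intro info_matrix_in_convex_hull) simp
  have max: "det A \<le> det S" if A: "A \<in> K" for A
  proof -
    obtain \<eta> where "is_design X \<eta>" "info_matrix f \<eta> \<theta>bar = A"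
      using convex_hull_imp_info_matrix[where f = f and \<tau> = \<theta>bar, OF A[unfolded K_def]] .
    then show ?thesis using opt by (auto simp: locally_D_optimal_def S_def)
  qed
  have det_S: "det S > 0"
    using max[of "M \<theta>bar nst"] M_in_hull[of nst \<theta>bar] pos_def_det_pos[OF M_pos_def[OF order_refl \<theta>bar_in]]
    by (simp add: K_def)
  have pd: "pos_def_matrix A" if "A \<in> K" "det A > 0" for A
  proof (rule pos_def_if_psd_det_pos)
    show "transpose A = A" "\<And>v. v \<bullet> (A *v v) \<ge> 0"
      using convex_hull_outer_products_psd[OF that(1)[unfolded K_def]] by simp_all
  qed fact
  show ?thesis unfolding S_def[symmetric]
  proof (rule tendsto_unique_maximizer[where K = K and \<phi> = det])
    show "compact K" unfolding K_def by (rule compact_hull[OF \<theta>bar_in])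
    show "continuous_on K det" by (intro continuous_intros)
    show "S \<in> K" by fact
    show "det A < det S" if "A \<in> K" "A \<noteq> S" for A
    proof (rule ccontr)
      assume "\<not> det A < det S"
      then have eq: "det A = det S" using max[OF that(1)] by linarith
      have "(1/2) *\<^sub>R A + (1/2) *\<^sub>R S \<in> K"
        using that(1) S unfolding K_def by (intro convexD[OF convex_convex_hull]) auto
      then have "A = S"
        using max eq det_S that(1) S by (intro det_maximizer_unique[OF pd pd _ eq refl]) auto
      then show False using that(2) by simp
    qed
    show "\<forall>\<^sub>F n in sequentially. M \<theta>bar n \<in> K"
      unfolding K_def using eventually_ge_at_top[of nst] by eventually_elim (rule M_in_hull)
    show "\<forall>\<^sub>F n in sequentially. c < det (M \<theta>bar n)" if "c < det S" for c
    proof -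
      have "((\<lambda>r. det S * exp (- 5 * r)) \<longlongrightarrow> det S * exp (- 5 * 0)) (at_right 0)"
        by (intro tendsto_intros)
      then have "\<forall>\<^sub>F r in at_right 0. c < det S * exp (- 5 * r)"
        using that by (intro order_tendstoD(1)) auto
      moreover have "\<forall>\<^sub>F r in at_right (0::real). r > 0" by (rule eventually_at_right_less)
      ultimately have "\<forall>\<^sub>F r in at_right 0. c < det S * exp (- 5 * r) \<and> r > 0"
        by (rule eventually_conj)
      then obtain r where r: "c < det S * exp (- 5 * r)" "r > 0"
        using eventually_happens'[OF trivial_limit_at_right_real] by blast
      have "\<forall>\<^sub>F n in sequentially. det S * exp (- 5 * r) \<le> det (M \<theta>bar n)"
        using S r(2) det_S unfolding K_def by (rule det_M_eventually_near_optimal)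
      then show ?thesis by eventually_elim (use r(1) in linarith)
    qed
  qed
qed

end

theorem theorem2p8:
  fixes X :: "'a::metric_space set"
    and \<Theta> :: "'b::metric_space set"
    and f :: "'b \<Rightarrow> 'a \<Rightarrow> real^'p"
    and nst :: nat
    and \<theta> \<theta>' :: "nat \<Rightarrow> 'b"
    and \<theta>bar :: 'b
    and x :: "nat \<Rightarrow> 'a"
  assumes "compact X" and "X \<noteq> {}"
    and "compact \<Theta>" and "\<Theta> \<noteq> {}"
    and "\<And>\<tau>. \<tau> \<in> \<Theta> \<Longrightarrow> span (f \<tau> ` X) = UNIV"
    and "continuous_on (X \<times> \<Theta>) (\<lambda>(y, \<tau>). f \<tau> y)"
    and "\<And>n. n \<ge> nst \<Longrightarrow> \<theta> n \<in> \<Theta>"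
    and "wynn_sequence f X \<Theta> nst \<theta> x"
    and "\<theta>bar \<in> \<Theta>"
    and "\<theta> \<longlonglongrightarrow> \<theta>bar"
    and "\<And>n. n \<ge> nst \<Longrightarrow> \<theta>' n \<in> \<Theta>"
    and "\<theta>' \<longlonglongrightarrow> \<theta>bar"
  shows "(\<exists>\<xi>. locally_D_optimal f X \<theta>bar \<xi>) \<and>
    (\<forall>\<xi>. locally_D_optimal f X \<theta>bar \<xi> \<longrightarrow>
      (\<lambda>n. info_matrix f (empirical_design x n) (\<theta>' n)) \<longlonglongrightarrow> info_matrix f \<xi> \<theta>bar)"
proof -
  interpret convergent_wynn X \<Theta> f nst \<theta> \<theta>bar x
    by unfold_locales (use assms in auto)
  have \<theta>'_in: "\<forall>\<^sub>F n in sequentially. \<theta>' n \<in> \<Theta>"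
    using assms(11) by (auto simp: eventually_sequentially)
  have "(\<lambda>n. M (\<theta>' n) n) \<longlonglongrightarrow> info_matrix f \<xi> \<theta>bar" if opt: "locally_D_optimal f X \<theta>bar \<xi>" for \<xi>
  proof (rule tendstoI)
    fix e :: real assume "e > 0"
    then have e: "e / 2 > 0" by simp
    show "\<forall>\<^sub>F n in sequentially. dist (M (\<theta>' n) n) (info_matrix f \<xi> \<theta>bar) < e"
      using M_close[OF \<theta>'_in assms(12) e] tendstoD[OF M_tendsto_optimal[OF opt] e]
      by eventually_elim (metis dist_commute dist_triangle_half_r)
  qed
  then show ?thesis using exists_locally_D_optimal by blast
qed

end
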